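(* Let $k\ge 2$ be an integer, and let $\gamma\in(0,1]$, $\varepsilon>0$ and $\alpha,\delta\in(0,1)$. For a parameter $\lambda>0$, consider the following private-coin shuffle protocol $\mathcal{P}_{\mathsf{UT}}=(\mathcal{R}_{\mathsf{UT}},\mathcal{A}_{\mathsf{UT}})$ for $N\sim\mathbf{Poi}(n)$ users (the value of $N$ is known to the users and to the analyser), each holding one sample $x\in[k]$. Randomiser $\mathcal{R}_{\mathsf{UT}}(x)$: for each $j\in[k]$, output the message $(j,\mathbf{1}\{x=j\})$; then draw $s_j\sim\mathbf{Poi}(\lambda/N)$ and output $s_j$ further messages $(j,b_{j,1}),\dots,(j,b_{j,s_j})$, with $b_{j,t}\sim\mathrm{Bernoulli}(1/2)$ independent. All randomness is independent across users and coordinates. Analyser $\mathcal{A}_{\mathsf{UT}}$: given the shuffled multiset of all messages, set $\mu=\frac{n}{k}+\frac{\lambda}{2}$, let $N_j$ be the number of messages equal to $(j,1)$, compute $Z=\frac{k}{n}\sum_{j=1}^k\big((N_j-\mu)^2-N_j\big)$, and output ``not uniform'' if $Z>2n\alpha^2$ and ``uniform'' otherwise. Then there exists $\lambda=\lambda(\varepsilon,\delta)\in\mathbb{R}$ such that $\mathcal{P}_{\mathsf{UT}}$ is $(2\varepsilon,4\delta^\gamma,\gamma)$-robustly shuffle private. Moreover, for $\varepsilon=O(1)$ and $\delta=o(1)$, $\mathcal{P}_{\mathsf{UT}}$ solves $\alpha$-uniformity testing with sample complexity \[ n=O\Big(\frac{k^{3/4}}{\alpha\varepsilon}\log^{1/2}\frac1\delta+\frac{k^{1/2}}{\alpha^2}\Big).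 \]
   Context: Two datasets in $\mathcal{X}^m$ are adjacent if they differ in at most one entry. A randomised algorithm $\mathcal{M}:\mathcal{X}^m\to\mathcal{Z}$ is $(\varepsilon,\delta)$-differentially private (DP) if $\Pr[\mathcal{M}(\vec x)\in S]\le e^\varepsilon\Pr[\mathcal{M}(\vec x')\in S]+\delta$ for all measurable $S$ and all adjacent $\vec x,\vec x'$. In a (non-interactive) shuffle protocol, each user applies a randomiser $\mathcal{R}$ to its data point producing a tuple of messages, a shuffler $\mathcal{S}$ concatenates all users' tuples and outputs a uniformly random permutation of them, and an analyser computes the output from the shuffled messages. The protocol is $(\varepsilon',\delta',\gamma)$-robustly shuffle private if, for every fixed public randomness, the shuffler's output on the messages of any $\gamma$-fraction of the users (i.e. $\mathcal{S}\circ\mathcal{R}^{\gamma m}$, viewed as a function of those users' data) is $(\varepsilon',\delta')$-DP. $\mathbf{U}=\mathbf{U}_k$ denotes the uniform distribution on $[k]=\{1,\dots,k\}$ and $d_{TV}(\mathbf{p},\mathbf{q})=\frac12\|\mathbf{p}-\mathbf{q}\|_1$. A protocol solves $\alpha$-uniformity testing with sample complexity $n$ if, when the users' samples are i.i.d. from an unknown distribution $\mathbf{p}$ on $[k]$ (here with a Poissonised number $N\sim\mathbf{Poi}(n)$ of users), it outputs ``uniform'' with probability at least $2/3$ when $\mathbf{p}=\mathbf{U}$, and ``not uniform'' with probability at least $2/3$ when $d_{TV}(\mathbf{p},\mathbf{U})>\alpha$. *)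

theory Defs
  imports "HOL-Probability.Probability" "HOL-Combinatorics.Multiset_Permutations"
begin

text \<open>Poisson distribution with mean r; Poi(0) is the point mass at 0
  (the library's poisson_pmf is only specified for positive rates).\<close>
definition poi :: "real \<Rightarrow> nat pmf" where
  "poi r = (if r \<le> 0 then return_pmf 0 else poisson_pmf r)"

fun seq_pmf :: "'a pmf list \<Rightarrow> 'a list pmf" where
  "seq_pmf [] = return_pmf []"
| "seq_pmf (p # ps) = bind_pmf p (\<lambda>x. map_pmf (\<lambda>xs. x # xs) (seq_pmf ps))"

text \<open>The shuffler: a uniformly random permutation of the list of messages
  (uniform over all distinct rearrangements, which is the push-forward of a
  uniformly random permutation of positions).\<close>
definition shuffle :: "'a list \<Rightarrow> 'a list pmf" where
  "shuffle xs = pmf_of_set (permutations_of_multiset (mset xs))"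

definition adjacent :: "'a list \<Rightarrow> 'a list \<Rightarrow> bool" where
  "adjacent xs ys \<longleftrightarrow> length xs = length ys \<and>
     card {i. i < length xs \<and> xs ! i \<noteq> ys ! i} \<le> 1"

definition diff_private ::
  "'x set \<Rightarrow> nat \<Rightarrow> ('x list \<Rightarrow> 'z pmf) \<Rightarrow> real \<Rightarrow> real \<Rightarrow> bool" where
  "diff_private X m M eps del \<longleftrightarrow>
     (\<forall>xs ys S. length xs = m \<longrightarrow> set xs \<subseteq> X \<longrightarrow> set ys \<subseteq> X \<longrightarrow> adjacent xs ys \<longrightarrow>
        measure_pmf.prob (M xs) S \<le> exp eps * measure_pmf.prob (M ys) S + del)"

definition tv_dist_k :: "nat \<Rightarrow> nat pmf \<Rightarrow> nat pmf \<Rightarrow> real" where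
  "tv_dist_k k p q = (1/2) * (\<Sum>i\<in>{1..k}. \<bar>pmf p i - pmf q i\<bar>)"

definition unif :: "nat \<Rightarrow> nat pmf" where
  "unif k = pmf_of_set {1..k}"

text \<open>Messages are pairs (j, b) with j in [k] and b a bit (True = 1).\<close>
type_synonym msg = "nat \<times> bool"

definition coins :: "nat \<Rightarrow> nat \<Rightarrow> msg list pmf" where
  "coins j s = map_pmf (map (\<lambda>b. (j, b))) (seq_pmf (replicate s (bernoulli_pmf (1/2))))"

definition ut_block :: "real \<Rightarrow> nat \<Rightarrow> nat \<Rightarrow> nat \<Rightarrow> msg list pmf" where
  "ut_block lam N x j =
     bind_pmf (poi (lam / real N)) (\<lambda>s. map_pmf (\<lambda>cs. (j, x = j) # cs) (coins j s))"

definition ut_randomiser :: "nat \<Rightarrow> real \<Rightarrow> nat \<Rightarrow> nat \<Rightarrow> msg list pmf" where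
  "ut_randomiser k lam N x = map_pmf concat (seq_pmf (map (ut_block lam N x) [1..<k+1]))"

definition ut_shuffled :: "nat \<Rightarrow> real \<Rightarrow> nat \<Rightarrow> nat list \<Rightarrow> msg list pmf" where
  "ut_shuffled k lam N xs =
     bind_pmf (seq_pmf (map (ut_randomiser k lam N) xs)) (\<lambda>outs. shuffle (concat outs))"

text \<open>Analyser A_UT; result True means ``not uniform''.\<close>
definition ut_analyser :: "nat \<Rightarrow> real \<Rightarrow> real \<Rightarrow> real \<Rightarrow> msg list \<Rightarrow> bool" where
  "ut_analyser k n alpha lam y =
     (let mu = n / real k + lam / 2;
          Nc = (\<lambda>j. real (length (filter (\<lambda>m. m = (j, True)) y)));
          Z = real k / n * (\<Sum>j\<in>{1..k}. (Nc j - mu)^2 - Nc j)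
      in Z > 2 * n * alpha^2)"

definition ut_protocol :: "nat \<Rightarrow> real \<Rightarrow> real \<Rightarrow> real \<Rightarrow> nat pmf \<Rightarrow> bool pmf" where
  "ut_protocol k lam n alpha p =
     bind_pmf (poi n) (\<lambda>N.
     bind_pmf (seq_pmf (replicate N p)) (\<lambda>xs.
     map_pmf (ut_analyser k n alpha lam) (ut_shuffled k lam N xs)))"

text \<open>(eps', delta', gamma)-robust shuffle privacy (no public randomness):
  for every number N of users, the shuffled messages of any set of at least
  a gamma-fraction of the users is (eps', delta')-DP in those users' data.\<close>
definition ut_robust_private :: "nat \<Rightarrow> real \<Rightarrow> real \<Rightarrow> real \<Rightarrow> real \<Rightarrow> bool" where
  "ut_robust_private k lam eps' del' gamma \<longleftrightarrow>
     (\<forall>N m. gamma * real N \<le> real m \<longrightarrow> m \<le> N \<longrightarrow>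
        diff_private {1..k} m (ut_shuffled k lam N) eps' del')"

definition ut_solves :: "nat \<Rightarrow> real \<Rightarrow> real \<Rightarrow> real \<Rightarrow> bool" where
  "ut_solves k lam alpha n \<longleftrightarrow>
     measure_pmf.prob (ut_protocol k lam n alpha (unif k)) {False} \<ge> 2/3 \<and>
     (\<forall>p. set_pmf p \<subseteq> {1..k} \<longrightarrow> tv_dist_k k p (unif k) > alpha \<longrightarrow>
        measure_pmf.prob (ut_protocol k lam n alpha p) {True} \<ge> 2/3)"

end

theory Submission
  imports Defs
begin

text \<open>
  The laws of sums of independent variables form a commutative monoid under convolution, so write
  \<open>+\<close> for it. Poisson variables add up, and a Poisson number of i.i.d. draws is a family of
  independent Poisson counts. Since shuffling only forgets order, the output of \<open>m\<close> of the \<open>N\<close>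
  users is determined by a multiset of messages: a deterministic part depending on the data, plus
  independent \<open>Poi (m \<lambda> / (2 N))\<close> many copies of each message \<open>(j, b)\<close>.

  Privacy: changing one datum from \<open>x\<close> to \<open>y\<close> moves one message from \<open>(x, 1)\<close> to \<open>(x, 0)\<close> and one
  from \<open>(y, 0)\<close> to \<open>(y, 1)\<close>. For a single \<open>j\<close>, the likelihood ratio of the counts \<open>(u, v)\<close> of the
  two noisy bits is \<open>u / v\<close>, and a Chernoff bound controls the event \<open>u > exp \<epsilon> * v\<close>. Choosing
  \<open>\<lambda>\<close> of order \<open>ln (1 / \<delta>) / \<epsilon>\<^sup>2\<close> makes this probability at most \<open>2 * \<delta> powr \<gamma>\<close> for each of
  the two affected values of \<open>j\<close>.

  Utility: up to the event \<open>N = 0\<close>, the counts \<open>N\<^sub>j\<close> are independent Poisson variables of means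
  \<open>\<nu>\<^sub>j = n p\<^sub>j + \<lambda> / 2\<close>. The terms \<open>(N\<^sub>j - \<mu>)\<^sup>2 - N\<^sub>j\<close> have mean \<open>(\<nu>\<^sub>j - \<mu>)\<^sup>2\<close> and variance
  \<open>2 \<nu>\<^sub>j\<^sup>2 + 4 (\<nu>\<^sub>j - \<mu>)\<^sup>2 \<nu>\<^sub>j\<close>, and Chebyshev's inequality separates the two hypotheses.
\<close>

subsection \<open>Convolution of laws and Poisson multisets\<close>

text \<open>As a class instance, convolution inherits \<open>sum\<close>, \<open>sum_list\<close>
  and \<open>ac_simps\<close>, so independent parts of a multiset of messages can be regrouped like
  numbers.\<close>

instantiation pmf :: (comm_monoid_add) comm_monoid_add
begin

definition zero_pmf :: "'a pmf" where
  "0 = return_pmf 0"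

definition plus_pmf :: "'a pmf \<Rightarrow> 'a pmf \<Rightarrow> 'a pmf" where
  "p + q = bind_pmf p (\<lambda>a. map_pmf (\<lambda>b. a + b) q)"

instance
proof
  fix p q r :: "'a pmf"
  show "p + q + r = p + (q + r)"
    by (simp add: plus_pmf_def map_pmf_def bind_assoc_pmf bind_return_pmf add.assoc)
  show "p + q = q + p"
    unfolding plus_pmf_def map_pmf_def
    by (subst bind_commute_pmf) (simp add: add.commute)
  show "0 + p = p"
    by (simp add: plus_pmf_def zero_pmf_def bind_return_pmf map_pmf_def bind_return_pmf')
qed

end

lemma return_pmf_plus: "return_pmf (a + b) = return_pmf a + return_pmf b"
  by (simp add: plus_pmf_def bind_return_pmf)

lemma return_pmf_sum: "return_pmf (\<Sum>x\<in>S. f x) = (\<Sum>x\<in>S. return_pmf (f x))"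
  by (induction S rule: infinite_finite_induct) (auto simp: return_pmf_plus zero_pmf_def)

lemma return_pmf_plus_eq_map: "return_pmf a + p = map_pmf (\<lambda>b. a + b) p"
  by (simp add: plus_pmf_def bind_return_pmf)

lemma map_pmf_plus:
  assumes "\<And>a b. h (a + b) = h a + h b"
  shows "map_pmf h (p + q) = map_pmf h p + map_pmf h q"
  by (simp add: plus_pmf_def map_pmf_def bind_assoc_pmf bind_return_pmf assms)

lemma map_pmf_sum:
  assumes "\<And>a b. h (a + b) = h a + h b" "h 0 = 0"
  shows "map_pmf h (\<Sum>x\<in>S. p x) = (\<Sum>x\<in>S. map_pmf h (p x))"
  by (induction S rule: infinite_finite_induct)
     (auto simp: map_pmf_plus[of h] assms zero_pmf_def)

text \<open>Concatenation becomes addition once order is forgotten, and the entries drawn by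
  \<open>seq_pmf\<close> are independent.\<close>

lemma map_pmf_mset_concat_seq_pmf:
  "map_pmf (\<lambda>xs. mset (concat xs)) (seq_pmf ps) = (\<Sum>p\<leftarrow>ps. map_pmf mset p)"
proof (induction ps)
  case (Cons p ps)
  show ?case
    by (simp flip: Cons.IH)
       (simp add: plus_pmf_def map_pmf_def bind_assoc_pmf bind_return_pmf)
qed (simp add: zero_pmf_def)

section \<open>Poisson laws and Poisson multisets\<close>

lemma pmf_poi: "r \<ge> 0 \<Longrightarrow> pmf (poi r) i = r ^ i / fact i * exp (- r)"
  by (auto simp: poi_def power_0_left)

lemma poi_0 [simp]: "poi 0 = 0"
  by (simp add: poi_def zero_pmf_def)

text \<open>The convolution sum is the binomial expansion of \<open>(a + b) ^ n\<close> over
  \<open>fact n\<close>.\<close>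

lemma poi_plus:
  assumes "a \<ge> 0" "b \<ge> 0"
  shows "poi a + poi b = poi (a + b)"
proof (rule pmf_eqI)
  fix n
  have "pmf (map_pmf (\<lambda>b. i + b) (poi b)) n = (if i \<le> n then pmf (poi b) (n - i) else 0)" for i
  proof (cases "i \<le> n")
    case True
    then have "pmf (map_pmf (\<lambda>b. i + b) (poi b)) (i + (n - i)) = pmf (poi b) (n - i)"
      by (intro pmf_map_inj') (auto simp: inj_def)
    with True show ?thesis by simp
  next
    case False
    then show ?thesis by (auto intro!: pmf_map_outside)
  qed
  then have "pmf (poi a + poi b) n =
      measure_pmf.expectation (poi a) (\<lambda>i. if i \<le> n then pmf (poi b) (n - i) else 0)"
    by (simp add: plus_pmf_def pmf_bind)
  also have "\<dots> = (\<Sum>i\<le>n. (if i \<le> n then pmf (poi b) (n - i) else 0) * pmf (poi a) i)"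
    by (intro integral_measure_pmf_real) (auto split: if_splits)
  also have "\<dots> = (\<Sum>i\<le>n. of_nat (n choose i) * a ^ i * b ^ (n - i) * (exp (- (a + b)) / fact n))"
    using assms by (intro sum.cong) (auto simp: pmf_poi binomial_fact exp_add[symmetric] field_simps)
  also have "\<dots> = pmf (poi (a + b)) n"
    using assms by (simp add: pmf_poi binomial_ring sum_distrib_right sum_divide_distrib)
  finally show "pmf (poi a + poi b) n = pmf (poi (a + b)) n" .
qed

text \<open>The Poisson point process on a finite set \<open>S\<close> with intensity
  \<open>f\<close>. Written as a convolution over the points, so that superposition and splitting of
  \<open>S\<close> become rules for sums.\<close>

definition poisson_mset :: "('a \<Rightarrow> real) \<Rightarrow> 'a set \<Rightarrow> 'a multiset pmf" where
  "poisson_mset f S = (\<Sum>x\<in>S. map_pmf (\<lambda>n. replicate_mset n x) (poi (f x)))"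

lemma replicate_mset_plus: "replicate_mset (a + b) x = replicate_mset a x + replicate_mset b x"
  by (induction a) auto

lemma poisson_mset_plus:
  assumes "\<And>x. x \<in> S \<Longrightarrow> f x \<ge> 0" "\<And>x. x \<in> S \<Longrightarrow> g x \<ge> 0"
  shows "poisson_mset f S + poisson_mset g S = poisson_mset (\<lambda>x. f x + g x) S"
  unfolding poisson_mset_def sum.distrib[symmetric]
  using assms by (intro sum.cong)
    (auto simp: poi_plus[symmetric] intro!: map_pmf_plus[symmetric] replicate_mset_plus)

lemma poisson_mset_0 [simp]: "poisson_mset (\<lambda>_. 0) S = 0"
  by (simp add: poisson_mset_def) (simp add: zero_pmf_def flip: return_pmf_sum)

lemma sum_list_poisson_mset:
  assumes "c \<ge> 0"
  shows "(\<Sum>x\<leftarrow>xs. poisson_mset (\<lambda>_. c) S) = poisson_mset (\<lambda>_. real (length xs) * c) S"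
  using assms by (induction xs) (simp_all add: poisson_mset_plus algebra_simps)

text \<open>Passes from convolutions to a product law of counts, the form in which point masses and
  moments are computed.\<close>

lemma poisson_mset_Pi_pmf:
  assumes "finite S"
  shows "poisson_mset f S = map_pmf (\<lambda>c. \<Sum>x\<in>S. replicate_mset (c x) x) (Pi_pmf S 0 (\<lambda>x. poi (f x)))"
  using assms
proof (induction S rule: finite_induct)
  case empty
  show ?case by (simp add: poisson_mset_def zero_pmf_def)
next
  case (insert a S)
  have *: "(\<Sum>x\<in>S. replicate_mset (if x = a then y else c x) x) = (\<Sum>x\<in>S. replicate_mset (c x) x)" for y c
    using insert.hyps by (intro sum.cong) auto
  have "poisson_mset f (insert a S) = map_pmf (\<lambda>n. replicate_mset n a) (poi (f a)) + poisson_mset f S"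
    using insert.hyps by (simp add: poisson_mset_def)
  also have "\<dots> = map_pmf (\<lambda>c. \<Sum>x\<in>insert a S. replicate_mset (c x) x)
      (Pi_pmf (insert a S) 0 (\<lambda>x. poi (f x)))"
    unfolding insert.IH Pi_pmf_insert'[OF insert.hyps] plus_pmf_def
    using insert.hyps
    by (simp add: map_pmf_def bind_assoc_pmf bind_return_pmf *)
  finally show ?case .
qed

lemma count_sum_replicate_mset:
  "finite S \<Longrightarrow> count (\<Sum>x\<in>S. replicate_mset (c x) x) y = (if y \<in> S then c y else 0)"
  by (simp add: count_sum sum.If_cases sum.delta if_distrib cong: if_cong)

lemma pmf_poisson_mset:
  assumes "finite S"
  shows "pmf (poisson_mset f S) A = (if set_mset A \<subseteq> S then \<Prod>x\<in>S. pmf (poi (f x)) (count A x) else 0)"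
proof -
  let ?\<Phi> = "\<lambda>c. \<Sum>x\<in>S. replicate_mset (c x) x" and ?P = "Pi_pmf S 0 (\<lambda>x. poi (f x))"
  \<comment> \<open>The default value 0 of the product law makes the counts vanish off
    \<open>S\<close>, so a count vector can equal \<open>count A\<close> as a function on the whole
    type.\<close>
  have supp: "c \<in> set_pmf ?P \<Longrightarrow> x \<notin> S \<Longrightarrow> c x = 0" for c x
    using set_Pi_pmf_subset[OF assms, of 0] by blast
  have "pmf (poisson_mset f S) A = measure_pmf.prob ?P (?\<Phi> -` {A})"
    by (simp add: poisson_mset_Pi_pmf[OF assms] pmf_map)
  also have "\<dots> = measure_pmf.prob ?P (if set_mset A \<subseteq> S then {count A} else {})"
  proof (rule measure_pmf.finite_measure_eq_AE, rule AE_pmfI)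
    fix c assume c: "c \<in> set_pmf ?P"
    have "?\<Phi> c = A \<longleftrightarrow> set_mset A \<subseteq> S \<and> c = count A"
      using supp[OF c] by (auto simp: multiset_eq_iff count_sum_replicate_mset[OF assms] fun_eq_iff count_eq_zero_iff subset_iff split: if_splits)
        (metis count_inI)+
    then show "c \<in> ?\<Phi> -` {A} \<longleftrightarrow> c \<in> (if set_mset A \<subseteq> S then {count A} else {})"
      by auto
  qed auto
  also have "\<dots> = (if set_mset A \<subseteq> S then \<Prod>x\<in>S. pmf (poi (f x)) (count A x) else 0)"
    using assms by (auto simp: measure_pmf_single subset_iff not_in_iff intro!: pmf_Pi')
  finally show ?thesis .
qed

text \<open>The multinomial masses, by conditioning on the first draw: the possible first values
  \<open>x\<close> carry the weights \<open>count A x\<close>, which add up to \<open>Suc s\<close>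
  and turn \<open>fact s\<close> into \<open>fact (Suc s)\<close>.\<close>

lemma pmf_iid_mset:
  assumes S: "finite S" "set_pmf p \<subseteq> S" and A: "set_mset A \<subseteq> S"
  shows "pmf (map_pmf mset (seq_pmf (replicate s p))) A =
    (if size A = s then fact s * (\<Prod>x\<in>S. pmf p x ^ count A x / fact (count A x)) else 0)"
  using A
proof (induction s arbitrary: A)
  case 0
  then show ?case
    by (auto simp: pmf_return)
next
  case (Suc s)
  define R where "R = map_pmf mset (seq_pmf (replicate s p))"
  define g where "g A = (\<Prod>x\<in>S. pmf p x ^ count A x / fact (count A x))" for A
  have IH: "pmf R A = (if size A = s then fact s * g A else 0)" if "set_mset A \<subseteq> S" for A
    using Suc.IH[OF that] by (simp add: R_def g_def)
  have step: "pmf p x * g (A - {#x#}) = g A * real (count A x)" if xA: "x \<in># A" for x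
  proof -
    have x: "x \<in> S" using xA Suc.prems by auto
    obtain c where c: "count A x = Suc c"
      using xA by (cases "count A x") (auto simp: count_eq_zero_iff)
    define P where "P = (\<Prod>y\<in>S-{x}. pmf p y ^ count A y / fact (count A y))"
    have "g (A - {#x#}) = pmf p x ^ c / fact c * P"
      unfolding g_def P_def prod.remove[OF S(1) x]
      by (intro arg_cong2[where f = "(*)"] prod.cong) (auto simp: c)
    moreover have "g A = pmf p x ^ Suc c / fact (Suc c) * P"
      unfolding g_def P_def prod.remove[OF S(1) x] by (simp add: c)
    moreover have "a * (a ^ c / fact c * P) = a ^ Suc c / fact (Suc c) * P * real (Suc c)" for a :: real
      by (simp add: divide_simps del: of_nat_Suc)
    ultimately show ?thesis by (simp only: c)
  qed
  have "pmf (map_pmf (add_mset x) R) A = (if x \<in># A then pmf R (A - {#x#}) else 0)" for x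
  proof (cases "x \<in># A")
    case True
    then have "pmf (map_pmf (add_mset x) R) (add_mset x (A - {#x#})) = pmf R (A - {#x#})"
      by (intro pmf_map_inj') (auto simp: inj_def)
    with True show ?thesis by simp
  next
    case False
    then show ?thesis by (auto intro!: pmf_map_outside)
  qed
  moreover have "map_pmf mset (seq_pmf (replicate (Suc s) p)) = bind_pmf p (\<lambda>x. map_pmf (add_mset x) R)"
    by (simp add: R_def map_bind_pmf map_pmf_comp)
  ultimately have "pmf (map_pmf mset (seq_pmf (replicate (Suc s) p))) A =
      measure_pmf.expectation p (\<lambda>x. if x \<in># A then pmf R (A - {#x#}) else 0)"
    by (simp add: pmf_bind)
  also have "\<dots> = (\<Sum>x\<in>S. (if x \<in># A then pmf R (A - {#x#}) else 0) * pmf p x)"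
    using S by (intro integral_measure_pmf_real) auto
  also have "\<dots> = (\<Sum>x\<in>S. if size A = Suc s then fact s * g A * real (count A x) else 0)"
  proof (intro sum.cong refl)
    fix x assume "x \<in> S"
    show "(if x \<in># A then pmf R (A - {#x#}) else 0) * pmf p x =
        (if size A = Suc s then fact s * g A * real (count A x) else 0)"
    proof (cases "x \<in># A")
      case True
      have "set_mset (A - {#x#}) \<subseteq> S" using Suc.prems by (meson in_diffD subset_iff)
      moreover have "size (A - {#x#}) = s \<longleftrightarrow> size A = Suc s"
        using True by (auto simp: size_Diff_singleton Suc_diff_1 dest!: multi_member_split)
      ultimately show ?thesis using True step[OF True] by (simp add: IH mult_ac)
    qed (simp add: count_eq_zero_iff[THEN iffD2])
  qed
  also have "\<dots> = (if size A = Suc s then fact s * g A * real (\<Sum>x\<in>S. count A x) else 0)"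
    by (simp add: sum_distrib_left)
  also have "(\<Sum>x\<in>S. count A x) = size A"
    using Suc.prems S by (simp add: size_multiset_overloaded_eq sum.mono_neutral_right not_in_iff)
  finally show ?case by (auto simp: g_def)
qed

lemma set_pmf_seq_pmf: "xs \<in> set_pmf (seq_pmf ps) \<Longrightarrow> set xs \<subseteq> (\<Union>p\<in>set ps. set_pmf p)"
  by (induction ps arbitrary: xs) fastforce+

lemma length_seq_pmf: "xs \<in> set_pmf (seq_pmf ps) \<Longrightarrow> length xs = length ps"
  by (induction ps arbitrary: xs) auto

text \<open>Poisson splitting: the factorial of the size cancels between the Poisson and the
  multinomial mass, and \<open>exp (- r)\<close> factors over \<open>S\<close> because the masses of
  \<open>p\<close> add up to 1.\<close>

lemma bind_poi_iid_mset:
  assumes S: "finite S" "set_pmf p \<subseteq> S" and r: "r \<ge> 0"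
  shows "bind_pmf (poi r) (\<lambda>s. map_pmf mset (seq_pmf (replicate s p))) = poisson_mset (\<lambda>x. r * pmf p x) S"
proof (rule pmf_eqI)
  fix A
  show "pmf (bind_pmf (poi r) (\<lambda>s. map_pmf mset (seq_pmf (replicate s p)))) A =
      pmf (poisson_mset (\<lambda>x. r * pmf p x) S) A"
  proof (cases "set_mset A \<subseteq> S")
    case True
    define g where "g = (\<Prod>x\<in>S. pmf p x ^ count A x / fact (count A x))"
    have size: "(\<Sum>x\<in>S. count A x) = size A"
      using True S by (simp add: size_multiset_overloaded_eq sum.mono_neutral_right not_in_iff)
    have "pmf (bind_pmf (poi r) (\<lambda>s. map_pmf mset (seq_pmf (replicate s p)))) A =
        measure_pmf.expectation (poi r) (\<lambda>s. if size A = s then fact s * g else 0)"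
      unfolding pmf_bind g_def by (simp add: pmf_iid_mset[OF S True])
    also have "\<dots> = (\<Sum>s\<in>{size A}. (if size A = s then fact s * g else 0) * pmf (poi r) s)"
      by (intro integral_measure_pmf_real) (auto split: if_splits)
    also have "\<dots> = r ^ size A * exp (- (r * (\<Sum>x\<in>S. pmf p x))) * g"
      using r S by (simp add: pmf_poi sum_pmf_eq_1)
    also have "\<dots> = (\<Prod>x\<in>S. pmf (poi (r * pmf p x)) (count A x))"
      using r by (simp add: pmf_poi g_def prod.distrib prod_dividef size[symmetric] power_sum
            exp_sum[OF S(1)] sum_distrib_left power_mult_distrib sum_negf[symmetric])
    finally show ?thesis using True S by (simp add: pmf_poisson_mset)
  next
    case False
    then have "A \<notin> set_pmf (map_pmf mset (seq_pmf (replicate s p)))" for s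
      using set_pmf_seq_pmf[of _ "replicate s p"] S(2) by (fastforce split: if_splits)
    then have "A \<notin> set_pmf (bind_pmf (poi r) (\<lambda>s. map_pmf mset (seq_pmf (replicate s p))))"
      by simp
    then show ?thesis using False S by (simp add: pmf_poisson_mset set_pmf_iff del: set_bind_pmf)
  qed
qed

section \<open>Law of the multiset of messages\<close>

definition messages :: "nat \<Rightarrow> msg set" where
  "messages k = {1..k} \<times> UNIV"

definition base_messages :: "nat \<Rightarrow> nat \<Rightarrow> msg multiset" where
  "base_messages k x = (\<Sum>j\<in>{1..k}. {#(j, x = j)#})"

text \<open>By Poisson splitting, a \<open>Poi (lam / N)\<close> number of fair coins amounts to two
  independent Poisson counts of half that rate.\<close>

lemma mset_ut_block:
  assumes "lam \<ge> 0"
  shows "map_pmf mset (ut_block lam N x j) =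
    return_pmf {#(j, x = j)#} + poisson_mset (\<lambda>_. lam / (2 * real N)) ({j} \<times> UNIV)"
proof -
  define p where "p = map_pmf (Pair j) (bernoulli_pmf (1/2))"
  have seq: "map_pmf (map (Pair j)) (seq_pmf (replicate s q)) = seq_pmf (replicate s (map_pmf (Pair j) q))" for s q
  proof (induction s)
    case (Suc s)
    show ?case
      by (simp flip: Suc.IH) (simp add: map_pmf_def bind_assoc_pmf bind_return_pmf)
  qed simp
  have "map_pmf mset (ut_block lam N x j) = return_pmf {#(j, x = j)#} +
      bind_pmf (poi (lam / real N)) (\<lambda>s. map_pmf mset (seq_pmf (replicate s p)))"
    unfolding ut_block_def coins_def return_pmf_plus_eq_map seq p_def
    by (simp add: map_bind_pmf map_pmf_comp)
  also have "bind_pmf (poi (lam / real N)) (\<lambda>s. map_pmf mset (seq_pmf (replicate s p))) =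
      poisson_mset (\<lambda>m. lam / real N * pmf p m) ({j} \<times> UNIV)"
    using assms by (intro bind_poi_iid_mset) (auto simp: p_def)
  also have "\<dots> = poisson_mset (\<lambda>_. lam / (2 * real N)) ({j} \<times> UNIV)"
  proof -
    have half: "pmf p (j, b) = 1/2" for b
      unfolding p_def by (subst pmf_map_inj') (cases b; simp add: inj_def)+
    have "lam / real N * pmf p m = lam / (2 * real N)" if "m \<in> {j} \<times> UNIV" for m
      using that by (auto simp: half)
    then show ?thesis unfolding poisson_mset_def by (intro sum.cong refl) (simp only:)
  qed
  finally show ?thesis .
qed

lemma mset_ut_randomiser:
  assumes "lam \<ge> 0"
  shows "map_pmf mset (ut_randomiser k lam N x) =
    return_pmf (base_messages k x) + poisson_mset (\<lambda>_. lam / (2 * real N)) (messages k)"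
proof -
  have "map_pmf mset (ut_randomiser k lam N x) =
      (\<Sum>j\<leftarrow>[1..<k+1]. map_pmf mset (ut_block lam N x j))"
    by (simp add: ut_randomiser_def map_pmf_comp map_pmf_mset_concat_seq_pmf comp_def del: upt_Suc)
  also have "\<dots> = (\<Sum>j\<in>{1..k}. map_pmf mset (ut_block lam N x j))"
    by (simp add: sum_list_distinct_conv_sum_set atLeastLessThanSuc_atLeastAtMost del: upt_Suc)
  also have "\<dots> = return_pmf (base_messages k x) +
      (\<Sum>j\<in>{1..k}. poisson_mset (\<lambda>_. lam / (2 * real N)) ({j} \<times> UNIV))"
    by (simp add: mset_ut_block[OF assms] sum.distrib return_pmf_sum base_messages_def)
  also have "(\<Sum>j\<in>{1..k}. poisson_mset (\<lambda>_. lam / (2 * real N)) ({j} \<times> UNIV)) =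
      poisson_mset (\<lambda>_. lam / (2 * real N)) (messages k)"
  proof -
    have "messages k = (\<Union>j\<in>{1..k}. {j} \<times> UNIV)"
      by (auto simp: messages_def)
    then show ?thesis
      unfolding poisson_mset_def by (simp only:) (subst sum.UNION_disjoint, auto)
  qed
  finally show ?thesis .
qed

lemma sum_list_return_pmf: "(\<Sum>x\<leftarrow>xs. return_pmf (f x)) = return_pmf (\<Sum>x\<leftarrow>xs. f x)"
  by (induction xs) (auto simp: zero_pmf_def return_pmf_plus)

text \<open>\<open>N\<close> calibrates the noise of each user, while \<open>length xs\<close>
  counts the users taking part. A fraction of the users thus carries the same fraction of the noise,
  which is the source of robustness.\<close>

lemma mset_ut_randomisers:
  assumes "lam \<ge> 0"
  shows "map_pmf (\<lambda>outs. mset (concat outs)) (seq_pmf (map (ut_randomiser k lam N) xs)) =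
    return_pmf (\<Sum>x\<leftarrow>xs. base_messages k x) +
    poisson_mset (\<lambda>_. real (length xs) * (lam / (2 * real N))) (messages k)"
  using assms
  by (simp add: map_pmf_mset_concat_seq_pmf comp_def mset_ut_randomiser sum_list_addf
      sum_list_return_pmf sum_list_poisson_mset)

text \<open>\<open>shuffle\<close> looks at the multiset only, so the output is a post-processing of
  a law in the convolution monoid.\<close>

lemma ut_shuffled_eq:
  assumes "lam \<ge> 0"
  shows "ut_shuffled k lam N xs =
    bind_pmf (return_pmf (\<Sum>x\<leftarrow>xs. base_messages k x) +
      poisson_mset (\<lambda>_. real (length xs) * (lam / (2 * real N))) (messages k))
     (\<lambda>A. pmf_of_set (permutations_of_multiset A))"
  unfolding mset_ut_randomisers[OF assms, symmetric] ut_shuffled_def shuffle_def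
  by (simp add: bind_map_pmf)

subsection \<open>Likelihood ratios and Poisson tails\<close>

text \<open>A bound on the likelihood ratio off a rare event gives approximate indistinguishability,
  and the kernel \<open>f\<close> is mere post-processing. Non-negative integrals avoid summability
  conditions.\<close>

lemma prob_bind_le_of_pmf_le:
  assumes K: "K \<ge> 0" and bad: "measure_pmf.prob p Bad \<le> d"
    and le: "\<And>z. z \<notin> Bad \<Longrightarrow> pmf p z \<le> K * pmf q z"
  shows "measure_pmf.prob (bind_pmf p f) S \<le> K * measure_pmf.prob (bind_pmf q f) S + d"
proof -
  have "emeasure (bind_pmf p f) S = (\<integral>\<^sup>+z. ennreal (pmf p z) * emeasure (f z) S \<partial>count_space UNIV)"
    by (simp add: nn_integral_measure_pmf)
  also have "\<dots> \<le> (\<integral>\<^sup>+z. ennreal K * (ennreal (pmf q z) * emeasure (f z) S) + ennreal (pmf p z) * indicator Bad z \<partial>count_space UNIV)"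
  proof (rule nn_integral_mono)
    fix z
    have "emeasure (f z) S \<le> 1" by (simp add: measure_pmf.emeasure_le_1)
    moreover have "ennreal (pmf p z) * emeasure (f z) S \<le> ennreal K * ennreal (pmf q z) * emeasure (f z) S" if "z \<notin> Bad"
      using le[OF that] K by (intro mult_right_mono) (auto simp flip: ennreal_mult)
    ultimately show "ennreal (pmf p z) * emeasure (f z) S
        \<le> ennreal K * (ennreal (pmf q z) * emeasure (f z) S) + ennreal (pmf p z) * indicator Bad z"
      by (cases "z \<in> Bad") (auto simp: mult.assoc intro!: add_increasing mult_left_le)
  qed
  also have "\<dots> = ennreal K * emeasure (bind_pmf q f) S + emeasure p Bad"
    by (simp add: nn_integral_add nn_integral_cmult flip: nn_integral_measure_pmf)
  finally have "ennreal (measure_pmf.prob (bind_pmf p f) S)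
      \<le> ennreal (K * measure_pmf.prob (bind_pmf q f) S + measure_pmf.prob p Bad)"
    using K by (simp add: measure_pmf.emeasure_eq_measure ennreal_mult ennreal_plus del: emeasure_bind_pmf)
  then have "measure_pmf.prob (bind_pmf p f) S \<le> K * measure_pmf.prob (bind_pmf q f) S + measure_pmf.prob p Bad"
    using K by (subst (asm) ennreal_le_iff) auto
  then show ?thesis using bad by linarith
qed

lemma nn_integral_exp_poi:
  assumes r: "r \<ge> 0"
  shows "(\<integral>\<^sup>+n. ennreal (exp (t * real n)) \<partial>poi r) = ennreal (exp (r * (exp t - 1)))"
proof -
  have *: "pmf (poi r) n * exp (t * real n) = exp (- r) * ((r * exp t) ^ n /\<^sub>R fact n)" for n
    using r by (simp add: pmf_poi power_mult_distrib exp_of_nat_mult[symmetric] mult.commute[of t] divide_inverse)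
  have "(\<integral>\<^sup>+n. ennreal (exp (t * real n)) \<partial>poi r) = (\<integral>\<^sup>+n. ennreal (pmf (poi r) n * exp (t * real n)) \<partial>count_space UNIV)"
    by (simp add: nn_integral_measure_pmf ennreal_mult')
  also have "\<dots> = (\<Sum>n. ennreal (exp (- r) * ((r * exp t) ^ n /\<^sub>R fact n)))"
    by (simp only: nn_integral_count_space_nat *)
  also have "\<dots> = ennreal (exp (- r) * exp (r * exp t))"
    using sums_mult[OF exp_converges[of "r * exp t"], of "exp (- r)"] r
    by (intro suminf_ennreal_eq) auto
  also have "exp (- r) * exp (r * exp t) = exp (r * (exp t - 1))"
    by (simp add: algebra_simps flip: exp_add)
  finally show ?thesis .
qed

text \<open>Chernoff bound: \<open>exp (t * (a + 1 - e * b))\<close> dominates the indicator of the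
  event, and its expectation factors into two Poisson moment generating functions. The
  \<open>+ 1\<close> stands for the noiseless message; \<open>e\<close> is the ratio itself, later
  taken to be \<open>exp e\<close>.\<close>

lemma poi_pair_tail:
  assumes r: "r \<ge> 0" and t: "t \<ge> 0"
  shows "measure_pmf.prob (pair_pmf (poi r) (poi r)) {(a, b). real a + 1 > e * real b} \<le>
    exp (t + r * (exp t - 1) + r * (exp (- (t * e)) - 1))"
proof -
  let ?P = "pair_pmf (poi r) (poi r)"
  define t' where "t' = - (t * e)"
  have "emeasure ?P {(a, b). real a + 1 > e * real b} = (\<integral>\<^sup>+z. indicator {(a, b). real a + 1 > e * real b} z \<partial>?P)"
    by simp
  also have "\<dots> \<le> (\<integral>\<^sup>+z. ennreal (exp (t * (real (fst z) + 1 - e * real (snd z)))) \<partial>?P)"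
    using t by (intro nn_integral_mono) (auto simp: indicator_def)
  also have "\<dots> = (\<integral>\<^sup>+z. ennreal (exp t) * (ennreal (exp (t * real (fst z))) * ennreal (exp (t' * real (snd z)))) \<partial>?P)"
    by (intro nn_integral_cong) (simp add: t'_def algebra_simps flip: ennreal_mult exp_add)
  also have "\<dots> = ennreal (exp t) * (\<integral>\<^sup>+a. \<integral>\<^sup>+b. ennreal (exp (t * real a)) * ennreal (exp (t' * real b)) \<partial>poi r \<partial>poi r)"
    by (simp add: nn_integral_cmult nn_integral_pair_pmf')
  also have "\<dots> = ennreal (exp t) * (ennreal (exp (r * (exp t - 1))) * ennreal (exp (r * (exp t' - 1))))"
    using r by (simp add: nn_integral_cmult nn_integral_multc nn_integral_exp_poi)
  also have "\<dots> = ennreal (exp (t + r * (exp t - 1) + r * (exp (- (t * e)) - 1)))"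
    by (simp add: exp_add t'_def flip: ennreal_mult)
  finally show ?thesis by (simp add: measure_pmf.emeasure_eq_measure)
qed

text \<open>The quadratic bound on the exponent has minimum \<open>- e^2 / 22\<close> per unit of
  \<open>r\<close>, whence the 22 in the hypothesis. The factor 2 absorbs \<open>exp t\<close> with
  \<open>t\<close> at most 1/11, the cost of the noiseless message.\<close>

lemma poi_pair_tail_delta:
  assumes e: "0 < e" "e \<le> 1" and d: "0 < d" and r: "r \<ge> 0" "r * e\<^sup>2 \<ge> 22 * ln (1 / d)"
  shows "measure_pmf.prob (pair_pmf (poi r) (poi r)) {(a, b). real a + 1 > exp e * real b} \<le> 2 * d"
proof -
  \<comment> \<open>The Chernoff exponent is at most \<open>t + r * (11 / 2 * t\<^sup>2 - t * e)\<close>; this \<open>t\<close> minimises the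
    factor of \<open>r\<close>.\<close>
  define t where "t = e / 11"
  define u where "u = t * exp e"
  have t: "0 \<le> t" "t \<le> 1" using e by (auto simp: t_def)
  \<comment> \<open>The linear terms \<open>t\<close> and \<open>- u\<close> of the two exponentials
    then leave at most \<open>- t * e\<close>.\<close>
  have u1: "u \<ge> t * (1 + e)"
    unfolding u_def using t by (intro mult_left_mono exp_ge_add_one_self) auto
  \<comment> \<open>This yields \<open>u^2 / 2 \<le> 9 / 2 * t^2\<close>, which together with
    \<open>t^2\<close> from \<open>exp t\<close> makes the coefficient 11/2.\<close>
  have "exp e \<le> 3" using e exp_le by (meson exp_le_cancel_iff order_trans)
  then have u2: "0 \<le> u" "u \<le> 3 * t"
    using t unfolding u_def by (auto intro!: mult_left_mono simp: mult.commute)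
  have "exp t \<le> 1 + t + t\<^sup>2" using exp_bound[of t] t by simp
  \<comment> \<open>The product of \<open>1 - u + u^2 / 2\<close> and \<open>1 + u + u^2 / 2\<close>
    is \<open>1 + u^4 / 4\<close>, so the lower Taylor bound for \<open>exp u\<close> inverts to an
    upper bound for \<open>exp (- u)\<close>.\<close>
  moreover have "exp (- u) \<le> 1 - u + u\<^sup>2 / 2"
  proof -
    have "1 + u + u\<^sup>2 / 2 \<le> exp u" using exp_lower_Taylor_quadratic[OF u2(1)] by simp
    moreover have "1 \<le> (1 - u + u\<^sup>2 / 2) * (1 + u + u\<^sup>2 / 2)"
      using zero_le_power[OF u2(1), of 4] by (simp add: power2_eq_square power4_eq_xxxx algebra_simps)
    moreover have pos: "0 < 1 - u + u\<^sup>2 / 2"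
      using sum_power2_gt_zero_iff[of "1 - u" 1] by (simp add: power2_eq_square algebra_simps)
    ultimately have "1 \<le> (1 - u + u\<^sup>2 / 2) * exp u"
      using mult_left_mono[of "1 + u + u\<^sup>2 / 2" "exp u" "1 - u + u\<^sup>2 / 2"] by linarith
    then show ?thesis by (simp add: exp_minus field_simps)
  qed
  moreover have "u\<^sup>2 \<le> 9 * t\<^sup>2"
    using power_mono[OF u2(2) u2(1), of 2] by (simp add: power_mult_distrib)
  ultimately have "(exp t - 1) + (exp (- u) - 1) \<le> t + t\<^sup>2 - t * (1 + e) + 9 * t\<^sup>2 / 2"
    using u1 by linarith
  also have "\<dots> = - (e\<^sup>2 / 22)"
    by (simp add: t_def power2_eq_square field_simps)
  finally have "r * ((exp t - 1) + (exp (- u) - 1)) \<le> r * (- (e\<^sup>2 / 22))"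
    using r by (intro mult_left_mono) auto
  moreover have "t \<le> 1 / 11" using e by (simp add: t_def)
  ultimately have "t + r * (exp t - 1) + r * (exp (- u) - 1) \<le> 1 / 11 + ln d"
    using r(2) d by (simp add: algebra_simps ln_div)
  then have "exp (t + r * (exp t - 1) + r * (exp (- (t * exp e)) - 1)) \<le> exp (1 / 11 + ln d)"
    by (simp only: u_def exp_le_cancel_iff)
  also have "\<dots> = exp (1 / 11) * d"
    using d by (simp add: exp_add)
  also have "\<dots> \<le> 2 * d"
    using exp_bound[of "1/11 :: real"] d by (simp add: power2_eq_square)
  finally show ?thesis
    using poi_pair_tail[OF r(1) t(1), of "exp e"] by linarith
qed

subsection \<open>Privacy\<close>

text \<open>Joint law of the numbers of messages \<open>(j, 1)\<close> and \<open>(j, 0)\<close> when a single noiseless message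
  is added to the noise: \<open>(j, 1)\<close> for \<open>shifted_up\<close>, \<open>(j, 0)\<close> for \<open>shifted_down\<close>.\<close>

definition shifted_up :: "real \<Rightarrow> (nat \<times> nat) pmf" where
  "shifted_up r = map_pmf (\<lambda>(a, b). (Suc a, b)) (pair_pmf (poi r) (poi r))"

definition shifted_down :: "real \<Rightarrow> (nat \<times> nat) pmf" where
  "shifted_down r = map_pmf (\<lambda>(a, b). (a, Suc b)) (pair_pmf (poi r) (poi r))"

lemma shifted_down_eq: "shifted_down r = map_pmf prod.swap (shifted_up r)"
  unfolding shifted_down_def shifted_up_def
  by (subst pair_commute_pmf) (simp add: map_pmf_comp case_prod_unfold)

lemma pmf_shifted_up: "pmf (shifted_up r) (u, v) = (if u = 0 then 0 else pmf (poi r) (u - 1) * pmf (poi r) v)"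
proof (cases u)
  case 0
  then show ?thesis unfolding shifted_up_def by (auto intro!: pmf_map_outside)
next
  case (Suc a)
  have "pmf (shifted_up r) ((\<lambda>(a, b). (Suc a, b)) (a, v)) = pmf (pair_pmf (poi r) (poi r)) (a, v)"
    unfolding shifted_up_def by (intro pmf_map_inj') (auto simp: inj_def)
  then show ?thesis by (simp add: Suc pmf_pair)
qed

lemma pmf_shifted_down: "pmf (shifted_down r) (u, v) = pmf (shifted_up r) (v, u)"
  using pmf_map_inj'[of prod.swap "shifted_up r" "(v, u)"] by (simp add: shifted_down_eq)

lemma shifted_up_le_shifted_down:
  assumes r: "r > 0" and "c \<ge> 0" and "real u \<le> c * real v"
  shows "pmf (shifted_up r) (u, v) \<le> c * pmf (shifted_down r) (u, v)"
proof (cases u)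
  case 0
  then show ?thesis using assms by (simp add: pmf_shifted_down pmf_shifted_up zero_le_mult_iff)
next
  case (Suc a)
  with assms(3) obtain b where v: "v = Suc b"
    by (cases v) auto
  \<comment> \<open>A common weight: at \<open>(u, v)\<close> the masses of the two shifted laws are
    \<open>w * u\<close> and \<open>w * v\<close>, hence their ratio is
    \<open>u / v\<close>.\<close>
  define w where "w = r ^ a / fact (Suc a) * exp (- r) * (r ^ Suc b / fact (Suc b) * exp (- r))"
  have "w \<ge> 0" using r by (simp add: w_def)
  have "pmf (shifted_up r) (u, v) = w * real u"
    using r by (simp add: pmf_shifted_up pmf_poi w_def Suc v divide_simps)
  moreover have "pmf (shifted_down r) (u, v) = w * real v"
    using r by (simp add: pmf_shifted_up pmf_shifted_down pmf_poi w_def Suc v divide_simps)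
  ultimately show ?thesis
    using mult_left_mono[OF assms(3) \<open>w \<ge> 0\<close>] by (simp add: mult_ac)
qed

text \<open>Each of the two affected coordinates costs a factor \<open>exp e\<close> and a bad event
  of probability \<open>2 * d\<close>. The second coordinate moves in the opposite direction, so its
  bad event is the mirror image of \<open>B\<close>.\<close>

lemma prob_shifted_pairs_le:
  assumes e: "0 < e" "e \<le> 1" and d: "0 < d" and r: "r > 0" "r * e\<^sup>2 \<ge> 22 * ln (1 / d)"
  shows "measure_pmf.prob (bind_pmf (pair_pmf (shifted_up r) (shifted_down r)) f) S
    \<le> exp (2 * e) * measure_pmf.prob (bind_pmf (pair_pmf (shifted_down r) (shifted_up r)) f) S + 4 * d"
proof (rule prob_bind_le_of_pmf_le)
  define B where "B = {(u, v). real u > exp e * real v}"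
  have "measure_pmf.prob (shifted_up r) B =
      measure_pmf.prob (pair_pmf (poi r) (poi r)) {(a, b). real a + 1 > exp e * real b}"
    unfolding shifted_up_def measure_map_pmf B_def
    by (rule arg_cong[where f = "measure_pmf.prob _"]) (auto simp: add.commute)
  then have up: "measure_pmf.prob (shifted_up r) B \<le> 2 * d"
    using poi_pair_tail_delta[OF e d, of r] r by simp
  have down: "measure_pmf.prob (shifted_down r) (prod.swap -` B) \<le> 2 * d"
    using up by (simp add: shifted_down_eq vimage_comp)
  let ?p = "pair_pmf (shifted_up r) (shifted_down r)"
  have fst: "measure_pmf.prob ?p (fst -` B) = measure_pmf.prob (shifted_up r) B"
    by (subst (2) map_fst_pair_pmf[symmetric, of _ "shifted_down r"]) simp
  have snd: "measure_pmf.prob ?p (snd -` (prod.swap -` B)) = measure_pmf.prob (shifted_down r) (prod.swap -` B)"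
    by (subst (2) map_snd_pair_pmf[symmetric, of _ "shifted_up r"]) simp
  show "measure_pmf.prob ?p (fst -` B \<union> snd -` (prod.swap -` B)) \<le> 4 * d"
    using measure_Un_le[of "fst -` B" ?p "snd -` (prod.swap -` B)"] up down fst snd by simp
  have exp2: "exp (2 * e) = exp e * exp e"
    by (simp flip: exp_add)
  fix z
  assume z: "z \<notin> fst -` B \<union> snd -` (prod.swap -` B)"
  obtain u v u' v' where z_eq: "z = ((u, v), (u', v'))" by (metis prod.exhaust)
  have "pmf (shifted_up r) (u, v) \<le> exp e * pmf (shifted_down r) (u, v)"
    using z by (intro shifted_up_le_shifted_down r(1)) (auto simp: z_eq B_def)
  moreover have "pmf (shifted_down r) (u', v') \<le> exp e * pmf (shifted_up r) (u', v')"
    using z shifted_up_le_shifted_down[of r "exp e" v' u'] r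
    by (auto simp: z_eq B_def pmf_shifted_down)
  ultimately have "pmf ?p z \<le> (exp e * pmf (shifted_down r) (u, v)) * (exp e * pmf (shifted_up r) (u', v'))"
    unfolding z_eq pmf_pair by (intro mult_mono) auto
  then show "pmf ?p z \<le> exp (2 * e) * pmf (pair_pmf (shifted_down r) (shifted_up r)) z"
    unfolding z_eq pmf_pair exp2 by (simp only: mult_ac)
qed simp

definition bit_counts_mset :: "nat \<Rightarrow> nat \<times> nat \<Rightarrow> msg multiset" where
  "bit_counts_mset j c = replicate_mset (fst c) (j, True) + replicate_mset (snd c) (j, False)"

lemma shifted_mset:
  "return_pmf {#(j, True)#} + poisson_mset (\<lambda>_. r) {(j, True), (j, False)} = map_pmf (bit_counts_mset j) (shifted_up r)"
  "return_pmf {#(j, False)#} + poisson_mset (\<lambda>_. r) {(j, True), (j, False)} = map_pmf (bit_counts_mset j) (shifted_down r)"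
  unfolding poisson_mset_def
  by (simp_all, simp_all add: plus_pmf_def shifted_up_def shifted_down_def pair_pmf_def
      map_pmf_def bind_assoc_pmf bind_return_pmf bit_counts_mset_def)

lemma poisson_mset_Un:
  assumes "finite S" "finite T" "S \<inter> T = {}"
  shows "poisson_mset f (S \<union> T) = poisson_mset f S + poisson_mset f T"
  using assms unfolding poisson_mset_def by (rule sum.union_disjoint)

text \<open>Isolates the part over the remaining \<open>j\<close>, which is the same set of messages
  when \<open>x\<close> and \<open>y\<close> are exchanged and so is common to both data
  sets.\<close>

lemma base_messages_swap:
  assumes "x \<in> {1..k}" "y \<in> {1..k}" "x \<noteq> y"
  shows "base_messages k x = (\<Sum>j\<in>{1..k}-{x}-{y}. {#(j, False)#}) + {#(x, True)#} + {#(y, False)#}"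
proof -
  have "base_messages k x = {#(x, True)#} + ({#(y, False)#} + (\<Sum>j\<in>{1..k}-{x}-{y}. {#(j, x = j)#}))"
    unfolding base_messages_def using assms
    by (subst sum.remove[of _ x], simp, simp, subst sum.remove[of _ y]) auto
  also have "(\<Sum>j\<in>{1..k}-{x}-{y}. {#(j, x = j)#}) = (\<Sum>j\<in>{1..k}-{x}-{y}. {#(j, False)#})"
    by (intro sum.cong) auto
  finally show ?thesis by simp
qed

lemma adjacent_cases:
  assumes "adjacent xs ys"
  obtains "xs = ys" | us x y vs where "xs = us @ x # vs" "ys = us @ y # vs" "x \<noteq> y"
proof (cases "xs = ys")
  case False
  let ?D = "{i. i < length xs \<and> xs ! i \<noteq> ys ! i}"
  have len: "length xs = length ys" and card: "card ?D \<le> 1"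
    using assms by (auto simp: adjacent_def)
  obtain i where i: "i < length xs" "xs ! i \<noteq> ys ! i"
    using False len by (auto simp: list_eq_iff_nth_eq)
  have same: "xs ! j = ys ! j" if "j < length xs" "j \<noteq> i" for j
  proof (rule ccontr)
    assume "xs ! j \<noteq> ys ! j"
    then have "{i, j} \<subseteq> ?D" using i that by auto
    then have "card {i, j} \<le> card ?D" by (intro card_mono) auto
    then show False using card that by simp
  qed
  have ys: "ys = xs[i := ys ! i]"
  proof (rule nth_equalityI)
    fix j assume "j < length ys"
    then show "ys ! j = xs[i := ys ! i] ! j"
      using same[of j] len i by (cases "j = i") auto
  qed (simp add: len)
  have "xs = take i xs @ xs ! i # drop (Suc i) xs" using i by (simp add: id_take_nth_drop)
  moreover have "ys = take i xs @ ys ! i # drop (Suc i) xs"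
    by (subst ys) (simp add: upd_conv_take_nth_drop i)
  ultimately show ?thesis using that(2) i by blast
qed (use that in auto)

lemma le_exp_mult: "0 \<le> c \<Longrightarrow> 0 \<le> p \<Longrightarrow> p \<le> exp c * p" for c p :: real
  using mult_right_mono[of 1 "exp c" p] by simp

lemma diff_private_ut_shuffled:
  assumes e: "0 < e" "e \<le> 1" and d: "0 < d" and "lam > 0" "N > 0" "m > 0"
    and r: "real m * (lam / (2 * real N)) * e\<^sup>2 \<ge> 22 * ln (1 / d)"
  shows "diff_private {1..k} m (ut_shuffled k lam N) (2 * e) (4 * d)"
  unfolding diff_private_def
proof (intro allI impI)
  fix xs ys S
  assume len: "length xs = m" and xs: "set xs \<subseteq> {1..k}" and ys: "set ys \<subseteq> {1..k}" and "adjacent xs ys"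
  define r where "r = real m * (lam / (2 * real N))"
  have "r > 0" using assms by (simp add: r_def)
  from \<open>adjacent xs ys\<close>
  show "measure_pmf.prob (ut_shuffled k lam N xs) S
      \<le> exp (2 * e) * measure_pmf.prob (ut_shuffled k lam N ys) S + 4 * d"
  proof (cases rule: adjacent_cases)
    case 1
    have "measure_pmf.prob (ut_shuffled k lam N ys) S \<le> exp (2 * e) * measure_pmf.prob (ut_shuffled k lam N ys) S"
      using e by (intro le_exp_mult) auto
    with 1 d show ?thesis by simp
  next
    case (2 us x y vs)
    have xy: "x \<in> {1..k}" "y \<in> {1..k}" using xs ys 2 by auto
    let ?X = "{(x, True), (x, False)}" and ?Y = "{(y, True), (y, False)}"
    \<comment> \<open>What both data sets share: the noiseless messages of the other users, the zero
      messages of the changed user away from \<open>x\<close> and \<open>y\<close>, and the noise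
      away from \<open>x\<close> and \<open>y\<close>.\<close>
    define C where "C = return_pmf ((\<Sum>z\<leftarrow>us @ vs. base_messages k z) + (\<Sum>j\<in>{1..k}-{x}-{y}. {#(j, False)#}))
      + poisson_mset (\<lambda>_. r) (messages k - (?X \<union> ?Y))"
    \<comment> \<open>The post-processing common to both data sets: rebuild the messages at
      \<open>x\<close> and \<open>y\<close> from their counts, add \<open>C\<close>, and
      permute.\<close>
    define f where "f = (\<lambda>(c, c'). bind_pmf (return_pmf (bit_counts_mset x c + bit_counts_mset y c') + C)
      (\<lambda>A. pmf_of_set (permutations_of_multiset A)))"
    have "poisson_mset (\<lambda>_. r) (messages k) = poisson_mset (\<lambda>_. r) ((?X \<union> ?Y) \<union> (messages k - (?X \<union> ?Y)))"
      using xy by (intro arg_cong[where f = "poisson_mset _"]) (auto simp: messages_def)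
    also have "\<dots> = poisson_mset (\<lambda>_. r) ?X + poisson_mset (\<lambda>_. r) ?Y + poisson_mset (\<lambda>_. r) (messages k - (?X \<union> ?Y))"
      using 2 by (subst poisson_mset_Un, simp, simp add: messages_def, simp, subst poisson_mset_Un) auto
    finally have noise: "poisson_mset (\<lambda>_. r) (messages k) = \<dots>" .
    have shuffled: "ut_shuffled k lam N zs =
        bind_pmf (return_pmf (\<Sum>z\<leftarrow>zs. base_messages k z) + poisson_mset (\<lambda>_. r) (messages k))
          (\<lambda>A. pmf_of_set (permutations_of_multiset A))" if "length zs = m" for zs
      using \<open>lam > 0\<close> that by (simp add: ut_shuffled_eq r_def)
    have D: "{1..k}-{y}-{x} = {1..k}-{x}-{y}" by auto
    have "return_pmf (\<Sum>z\<leftarrow>xs. base_messages k z) + poisson_mset (\<lambda>_. r) (messages k) =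
        (return_pmf {#(x, True)#} + poisson_mset (\<lambda>_. r) ?X) + (return_pmf {#(y, False)#} + poisson_mset (\<lambda>_. r) ?Y) + C"
      unfolding noise C_def 2 using base_messages_swap[OF xy \<open>x \<noteq> y\<close>]
      by (simp only: map_append sum_list_append list.map sum_list.Cons return_pmf_plus) (simp only: ac_simps)
    with len have x: "ut_shuffled k lam N xs = bind_pmf (pair_pmf (shifted_up r) (shifted_down r)) f"
      by (simp add: shuffled shifted_mset f_def)
        (simp add: plus_pmf_def pair_pmf_def map_pmf_def bind_assoc_pmf bind_return_pmf)
    have "return_pmf (\<Sum>z\<leftarrow>ys. base_messages k z) + poisson_mset (\<lambda>_. r) (messages k) =
        (return_pmf {#(x, False)#} + poisson_mset (\<lambda>_. r) ?X) + (return_pmf {#(y, True)#} + poisson_mset (\<lambda>_. r) ?Y) + C"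
      unfolding noise C_def 2 using base_messages_swap[OF xy(2,1) \<open>x \<noteq> y\<close>[symmetric]]
      by (simp only: map_append sum_list_append list.map sum_list.Cons return_pmf_plus D) (simp only: ac_simps)
    moreover have "length ys = m" using len 2 by simp
    ultimately have y: "ut_shuffled k lam N ys = bind_pmf (pair_pmf (shifted_down r) (shifted_up r)) f"
      by (simp add: shuffled shifted_mset f_def)
        (simp add: plus_pmf_def pair_pmf_def map_pmf_def bind_assoc_pmf bind_return_pmf)
    show ?thesis unfolding x y
      using prob_shifted_pairs_le[OF e d \<open>r > 0\<close>] r by (simp add: r_def)
  qed
qed

lemma diff_private_mono:
  assumes "diff_private X m M e d" "e \<le> e'"
  shows "diff_private X m M e' d"
  unfolding diff_private_def
proof (intro allI impI)
  fix xs ys S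
  assume "length xs = m" "set xs \<subseteq> X" "set ys \<subseteq> X" "adjacent xs ys"
  then have "measure_pmf.prob (M xs) S \<le> exp e * measure_pmf.prob (M ys) S + d"
    using assms(1) by (simp add: diff_private_def)
  also have "\<dots> \<le> exp e' * measure_pmf.prob (M ys) S + d"
    using assms(2) by (intro add_right_mono mult_right_mono) auto
  finally show "measure_pmf.prob (M xs) S \<le> exp e' * measure_pmf.prob (M ys) S + d" .
qed

section \<open>Choice of the noise rate\<close>

text \<open>44 is twice the 22 of the tail bound, since each of the two bits receives half of the
  noise. The minimum with 1 meets the condition \<open>e \<le> 1\<close> of that bound; for larger
  \<open>eps\<close> the guarantee is only weakened.\<close>

definition noise_rate :: "real \<Rightarrow> real \<Rightarrow> real" where
  "noise_rate eps del = 44 * ln (1 / del) / (min 1 eps)\<^sup>2"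

lemma noise_rate_pos: "eps > 0 \<Longrightarrow> 0 < del \<Longrightarrow> del < 1 \<Longrightarrow> noise_rate eps del > 0"
  by (simp add: noise_rate_def)

lemma ut_robust_private_noise_rate:
  assumes "eps > 0" "0 < del" "del < 1" "0 < gamma"
  shows "ut_robust_private k (noise_rate eps del) (2 * eps) (4 * del powr gamma) gamma"
  unfolding ut_robust_private_def
proof (intro allI impI)
  fix N m :: nat
  assume gm: "gamma * real N \<le> real m" and "m \<le> N"
  show "diff_private {1..k} m (ut_shuffled k (noise_rate eps del) N) (2 * eps) (4 * del powr gamma)"
  \<comment> \<open>Without participants there is no noise, but the empty list is the only data
    set.\<close>
  proof (cases "m = 0")
    case True
    have "measure_pmf.prob (ut_shuffled k (noise_rate eps del) N []) S
        \<le> exp (2 * eps) * measure_pmf.prob (ut_shuffled k (noise_rate eps del) N []) S" for S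
      using assms by (intro le_exp_mult) auto
    then show ?thesis
      using True assms by (auto simp: diff_private_def adjacent_def intro: add_increasing2)
  next
    case False
    define e where "e = min 1 eps"
    have e: "0 < e" "e \<le> 1" "e \<le> eps" using assms by (auto simp: e_def)
    have N: "N > 0" using False \<open>m \<le> N\<close> by simp
    \<comment> \<open>The exponent \<open>gamma\<close> becomes a factor of the logarithm, and
      \<open>m\<close> users hold a share \<open>m / N\<close> of at least \<open>gamma\<close> of
      the noise, which meets the reduced demand.\<close>
    have "22 * ln (1 / (del powr gamma)) = gamma * (22 * ln (1 / del))"
      using assms by (simp add: ln_div ln_powr)
    also have "\<dots> \<le> real m / real N * (22 * ln (1 / del))"
      using gm N assms by (intro mult_right_mono) (auto simp: field_simps)
    also have "\<dots> = real m * (noise_rate eps del / (2 * real N)) * e\<^sup>2"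
      using e(1) N by (simp add: noise_rate_def e_def[symmetric])
    finally have "diff_private {1..k} m (ut_shuffled k (noise_rate eps del) N) (2 * e) (4 * del powr gamma)"
      using e N False noise_rate_pos[of eps del] assms by (intro diff_private_ut_shuffled) auto
    then show ?thesis
      by (rule diff_private_mono) (use e in auto)
  qed
qed

subsection \<open>Moments of the test statistic\<close>

text \<open>The Stein-Chen identity: the term at 0 vanishes, \<open>n / fact n\<close> is
  \<open>1 / fact (n - 1)\<close>, and the series is shifted by one.\<close>

lemma nn_integral_poi_mult:
  assumes r: "r \<ge> 0" and g: "\<And>n. g n \<ge> 0"
  shows "(\<integral>\<^sup>+n. ennreal (real n * g n) \<partial>poi r) = ennreal r * (\<integral>\<^sup>+n. ennreal (g (Suc n)) \<partial>poi r)"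
proof -
  define f where "f n = ennreal (pmf (poi r) n * (real n * g n))" for n
  have f0: "f 0 = 0" by (simp add: f_def)
  have fSuc: "f (Suc n) = ennreal r * ennreal (pmf (poi r) n * g (Suc n))" for n
    using r g by (simp add: f_def pmf_poi divide_simps flip: ennreal_mult del: of_nat_Suc)
  have "(\<integral>\<^sup>+n. ennreal (real n * g n) \<partial>poi r) = (\<Sum>n. f n)"
    by (simp add: nn_integral_measure_pmf nn_integral_count_space_nat f_def flip: ennreal_mult')
  also have "\<dots> = (\<Sum>n. f (Suc n))"
    using suminf_offset[of f 1] by (simp add: f0)
  also have "\<dots> = ennreal r * (\<Sum>n. ennreal (pmf (poi r) n * g (Suc n)))"
    by (simp add: fSuc)
  also have "(\<Sum>n. ennreal (pmf (poi r) n * g (Suc n))) = (\<integral>\<^sup>+n. ennreal (g (Suc n)) \<partial>poi r)"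
    by (simp add: nn_integral_measure_pmf nn_integral_count_space_nat flip: ennreal_mult')
  finally show ?thesis .
qed

text \<open>Finiteness of the right-hand side also transports integrability, so moments can be
  obtained by recursion.\<close>

lemma expectation_poi_mult:
  assumes r: "r \<ge> 0" and g: "\<And>n. g n \<ge> 0"
    and int: "integrable (poi r) (\<lambda>n. g (Suc n))"
  shows "integrable (poi r) (\<lambda>n. real n * g n)"
    and "measure_pmf.expectation (poi r) (\<lambda>n. real n * g n) =
         r * measure_pmf.expectation (poi r) (\<lambda>n. g (Suc n))"
proof -
  have "(\<integral>\<^sup>+n. ennreal (real n * g n) \<partial>poi r) =
      ennreal (r * measure_pmf.expectation (poi r) (\<lambda>n. g (Suc n)))"
    unfolding nn_integral_poi_mult[OF r g]
    using r g int by (simp add: nn_integral_eq_integral ennreal_mult)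
  then have "integrable (poi r) (\<lambda>n. real n * g n) \<and>
      measure_pmf.expectation (poi r) (\<lambda>n. real n * g n) =
         r * measure_pmf.expectation (poi r) (\<lambda>n. g (Suc n))"
    using r g by (subst (asm) nn_integral_eq_integrable) auto
  then show "integrable (poi r) (\<lambda>n. real n * g n)"
    and "measure_pmf.expectation (poi r) (\<lambda>n. real n * g n) =
         r * measure_pmf.expectation (poi r) (\<lambda>n. g (Suc n))"
    by auto
qed

text \<open>With \<open>g\<close> a power, the Stein-Chen identity reduces each moment to an
  expanded power of \<open>Suc n\<close>, hence to lower moments.\<close>

lemma poi_moments:
  assumes r: "r \<ge> 0"
  shows "integrable (poi r) (\<lambda>n. real n)" "measure_pmf.expectation (poi r) (\<lambda>n. real n) = r"
    and "integrable (poi r) (\<lambda>n. real n ^ 2)"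
      "measure_pmf.expectation (poi r) (\<lambda>n. real n ^ 2) = r ^ 2 + r"
    and "integrable (poi r) (\<lambda>n. real n ^ 3)"
      "measure_pmf.expectation (poi r) (\<lambda>n. real n ^ 3) = r ^ 3 + 3 * r ^ 2 + r"
    and "integrable (poi r) (\<lambda>n. real n ^ 4)"
      "measure_pmf.expectation (poi r) (\<lambda>n. real n ^ 4) = r ^ 4 + 6 * r ^ 3 + 7 * r ^ 2 + r"
proof -
  show 1: "integrable (poi r) (\<lambda>n. real n)" "measure_pmf.expectation (poi r) (\<lambda>n. real n) = r"
    using expectation_poi_mult[OF r, of "\<lambda>_. 1"] by auto
  have "(\<lambda>n. real (Suc n)) = (\<lambda>n. real n + 1)" by auto
  then show 2: "integrable (poi r) (\<lambda>n. real n ^ 2)"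
      "measure_pmf.expectation (poi r) (\<lambda>n. real n ^ 2) = r ^ 2 + r"
    using expectation_poi_mult[OF r, of "\<lambda>n. real n"] 1
    by (auto simp: power2_eq_square algebra_simps)
  have "(\<lambda>n. real (Suc n) ^ 2) = (\<lambda>n. real n ^ 2 + 2 * real n + 1)"
    by (auto simp: power2_eq_square algebra_simps)
  then show 3: "integrable (poi r) (\<lambda>n. real n ^ 3)"
      "measure_pmf.expectation (poi r) (\<lambda>n. real n ^ 3) = r ^ 3 + 3 * r ^ 2 + r"
    using expectation_poi_mult[OF r, of "\<lambda>n. real n ^ 2"] 1 2
    by (auto simp: power2_eq_square power3_eq_cube algebra_simps)
  have eq: "(\<lambda>n. real (Suc n) ^ 3) = (\<lambda>n. real n ^ 3 + 3 * real n ^ 2 + 3 * real n + 1)"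
    by (auto simp: power2_eq_square power3_eq_cube algebra_simps)
  have "integrable (poi r) (\<lambda>n. real (Suc n) ^ 3)"
    unfolding eq using 1 2 3 by auto
  moreover have "measure_pmf.expectation (poi r) (\<lambda>n. real (Suc n) ^ 3) = r ^ 3 + 6 * r ^ 2 + 7 * r + 1"
    unfolding eq using 1 2 3 by simp
  moreover have "real n ^ 4 = real n * real n ^ 3" for n
    by (simp add: power3_eq_cube power4_eq_xxxx)
  ultimately show "integrable (poi r) (\<lambda>n. real n ^ 4)"
      "measure_pmf.expectation (poi r) (\<lambda>n. real n ^ 4) = r ^ 4 + 6 * r ^ 3 + 7 * r ^ 2 + r"
    using expectation_poi_mult[OF r, of "\<lambda>n. real n ^ 3"]
    by (auto simp: power2_eq_square power3_eq_cube power4_eq_xxxx algebra_simps)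
qed

text \<open>For a count of rate \<open>r\<close>, \<open>(n - mu)^2\<close> has mean
  \<open>(r - mu)^2 + r\<close>; subtracting \<open>n\<close> removes the variance term
  \<open>r\<close>, and the last term centres the result.\<close>

definition centred_stat :: "real \<Rightarrow> real \<Rightarrow> nat \<Rightarrow> real" where
  "centred_stat mu r n = (real n - mu)\<^sup>2 - real n - (r - mu)\<^sup>2"

lemma centred_stat_moments:
  assumes r: "r \<ge> 0"
  shows "integrable (poi r) (centred_stat mu r)"
    and "measure_pmf.expectation (poi r) (centred_stat mu r) = 0"
    and "integrable (poi r) (\<lambda>n. (centred_stat mu r n)\<^sup>2)"
    and "measure_pmf.expectation (poi r) (\<lambda>n. (centred_stat mu r n)\<^sup>2) = 2 * r\<^sup>2 + 4 * (r - mu)\<^sup>2 * r"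
proof -
  note m = poi_moments[OF r]
  define b where "b = 2 * mu + 1"
  define c where "c = mu\<^sup>2 - (r - mu)\<^sup>2"
  have 1: "centred_stat mu r = (\<lambda>n. real n ^ 2 - b * real n + c)"
    by (auto simp: centred_stat_def fun_eq_iff b_def c_def power2_eq_square algebra_simps)
  have 2: "(\<lambda>n. (centred_stat mu r n)\<^sup>2) =
      (\<lambda>n. real n ^ 4 - 2 * b * real n ^ 3 + (b\<^sup>2 + 2 * c) * real n ^ 2 - 2 * b * c * real n + c\<^sup>2)"
    unfolding 1 by (simp add: fun_eq_iff power2_eq_square power3_eq_cube power4_eq_xxxx algebra_simps)
  show "integrable (poi r) (centred_stat mu r)" "integrable (poi r) (\<lambda>n. (centred_stat mu r n)\<^sup>2)"
    unfolding 2 unfolding 1 using m by auto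
  show "measure_pmf.expectation (poi r) (centred_stat mu r) = 0"
    unfolding 1 using m by (simp add: b_def c_def power2_eq_square algebra_simps)
  have "measure_pmf.expectation (poi r) (\<lambda>n. (centred_stat mu r n)\<^sup>2) =
      (r ^ 4 + 6 * r ^ 3 + 7 * r\<^sup>2 + r) - 2 * b * (r ^ 3 + 3 * r\<^sup>2 + r) + (b\<^sup>2 + 2 * c) * (r\<^sup>2 + r)
        - 2 * b * c * r + c\<^sup>2"
    unfolding 2 using m by simp
  also have "\<dots> = 2 * r\<^sup>2 + 4 * (r - mu)\<^sup>2 * r"
    unfolding b_def c_def by algebra
  finally show "measure_pmf.expectation (poi r) (\<lambda>n. (centred_stat mu r n)\<^sup>2) = \<dots>" .
qed

text \<open>After expanding the square, the off-diagonal terms vanish because distinct coordinates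
  are independent and centred.\<close>

lemma Pi_pmf_second_moment:
  fixes g :: "'a \<Rightarrow> 'b \<Rightarrow> real" and p :: "'a \<Rightarrow> 'b pmf"
  assumes S: "finite S"
    and int: "\<And>x. x \<in> S \<Longrightarrow> integrable (p x) (g x)" "\<And>x. x \<in> S \<Longrightarrow> integrable (p x) (\<lambda>n. (g x n)\<^sup>2)"
    and zero: "\<And>x. x \<in> S \<Longrightarrow> measure_pmf.expectation (p x) (g x) = 0"
  shows "integrable (Pi_pmf S d p) (\<lambda>c. (\<Sum>x\<in>S. g x (c x))\<^sup>2)"
    and "measure_pmf.expectation (Pi_pmf S d p) (\<lambda>c. (\<Sum>x\<in>S. g x (c x))\<^sup>2) =
      (\<Sum>x\<in>S. measure_pmf.expectation (p x) (\<lambda>n. (g x n)\<^sup>2))"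
proof -
  let ?P = "Pi_pmf S d p"
  have marg: "map_pmf (\<lambda>c. c x) ?P = p x" if "x \<in> S" for x
    using that S by (simp add: Pi_pmf_component)
  have marg_int: "integrable ?P (\<lambda>c. h (c x))" "measure_pmf.expectation ?P (\<lambda>c. h (c x)) = measure_pmf.expectation (p x) h"
    if "x \<in> S" "integrable (p x) h" for x and h :: "'b \<Rightarrow> real"
    using that(2) unfolding marg[OF that(1), symmetric] by (auto simp: integrable_map_pmf_eq)
  have cross: "integrable ?P (\<lambda>c. g x (c x) * g y (c y)) \<and>
      measure_pmf.expectation ?P (\<lambda>c. g x (c x) * g y (c y)) =
      (if x = y then measure_pmf.expectation (p x) (\<lambda>n. (g x n)\<^sup>2) else 0)"
    if "x \<in> S" "y \<in> S" for x y
  proof (cases "x = y")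
    case True
    then show ?thesis
      using marg_int[OF that(1) int(2)[OF that(1)]] by (simp add: power2_eq_square)
  next
    case False
    have "prob_space.indep_vars ?P (\<lambda>_. count_space UNIV) (\<lambda>x c. c x) {x, y}"
      by (rule prob_space.indep_vars_subset[OF measure_pmf.prob_space_axioms indep_vars_Pi_pmf[OF S]]) (use that in simp)
    then have indep: "prob_space.indep_vars ?P (\<lambda>_. borel) (\<lambda>x c. g x (c x)) {x, y}"
      by (rule prob_space.indep_vars_compose2[OF measure_pmf.prob_space_axioms]) simp
    have "\<And>i. i \<in> {x, y} \<Longrightarrow> integrable ?P (\<lambda>c. g i (c i))"
      using that int(1) marg_int(1) by auto
    note prob_space.indep_vars_integrable[OF measure_pmf.prob_space_axioms _ indep this] prob_space.indep_vars_lebesgue_integral[OF measure_pmf.prob_space_axioms _ indep this]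
    then show ?thesis
      using False that int(1) zero by (simp add: marg_int(2))
  qed
  have eq: "(\<lambda>c. (\<Sum>x\<in>S. g x (c x))\<^sup>2) = (\<lambda>c. \<Sum>x\<in>S. \<Sum>y\<in>S. g x (c x) * g y (c y))"
    by (simp add: power2_eq_square sum_product)
  show "integrable ?P (\<lambda>c. (\<Sum>x\<in>S. g x (c x))\<^sup>2)"
    unfolding eq using cross by (intro Bochner_Integration.integrable_sum) auto
  show "measure_pmf.expectation ?P (\<lambda>c. (\<Sum>x\<in>S. g x (c x))\<^sup>2) =
      (\<Sum>x\<in>S. measure_pmf.expectation (p x) (\<lambda>n. (g x n)\<^sup>2))"
    unfolding eq using cross S by (simp add: Bochner_Integration.integral_sum Bochner_Integration.integrable_sum)
qed

lemma markov_square: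
  fixes f :: "'a \<Rightarrow> real"
  assumes "integrable (measure_pmf p) (\<lambda>x. (f x)\<^sup>2)" "a > 0"
  shows "measure_pmf.prob p {x. \<bar>f x\<bar> \<ge> a} \<le> measure_pmf.expectation p (\<lambda>x. (f x)\<^sup>2) / a\<^sup>2"
proof -
  have "measure_pmf.prob p {x. a\<^sup>2 \<le> (f x)\<^sup>2} \<le> measure_pmf.expectation p (\<lambda>x. (f x)\<^sup>2) / a\<^sup>2"
    using integral_Markov_inequality_measure[OF assms(1), of "{}" "a\<^sup>2"] assms(2) by simp
  moreover have "{x. a\<^sup>2 \<le> (f x)\<^sup>2} = {x. \<bar>f x\<bar> \<ge> a}"
    using assms(2) by (auto simp: abs_le_square_iff[symmetric])
  ultimately show ?thesis by simp
qed

lemma poi_stat_concentration: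
  assumes S: "finite S" and r: "\<And>j. j \<in> S \<Longrightarrow> r j \<ge> 0" and "a > 0"
  shows "measure_pmf.prob (Pi_pmf S 0 (\<lambda>j. poi (r j)))
      {c. \<bar>(\<Sum>j\<in>S. (real (c j) - mu)\<^sup>2 - real (c j)) - (\<Sum>j\<in>S. (r j - mu)\<^sup>2)\<bar> \<ge> a}
    \<le> (\<Sum>j\<in>S. 2 * (r j)\<^sup>2 + 4 * (r j - mu)\<^sup>2 * r j) / a\<^sup>2"
proof -
  have "(\<Sum>j\<in>S. (real (c j) - mu)\<^sup>2 - real (c j)) - (\<Sum>j\<in>S. (r j - mu)\<^sup>2) = (\<Sum>j\<in>S. centred_stat mu (r j) (c j))" for c
    by (simp add: centred_stat_def sum_subtractf)
  moreover note Pi_pmf_second_moment[OF S, of "\<lambda>j. poi (r j)" "\<lambda>j. centred_stat mu (r j)" 0]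
  ultimately show ?thesis
    using markov_square[OF _ \<open>a > 0\<close>, of "Pi_pmf S 0 (\<lambda>j. poi (r j))" "\<lambda>c. \<Sum>j\<in>S. centred_stat mu (r j) (c j)"]
    by (simp add: centred_stat_moments r)
qed

subsection \<open>Law of the test statistic\<close>

definition not_uniform :: "nat \<Rightarrow> real \<Rightarrow> real \<Rightarrow> real \<Rightarrow> (nat \<Rightarrow> nat) \<Rightarrow> bool" where
  "not_uniform k n alpha lam c \<longleftrightarrow>
     real k / n * (\<Sum>j\<in>{1..k}. (real (c j) - (n / real k + lam / 2))\<^sup>2 - real (c j)) > 2 * n * alpha\<^sup>2"

text \<open>The part of the messages that the analyser reads. As an additive map it commutes with
  convolution.\<close>

definition ones :: "msg multiset \<Rightarrow> nat multiset" where
  "ones A = image_mset fst (filter_mset snd A)"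

lemma ones_plus: "ones (A + B) = ones A + ones B"
  by (simp add: ones_def)

lemma ones_empty [simp]: "ones {#} = {#}"
  by (simp add: ones_def)

lemma count_ones: "count (ones A) j = count A (j, True)"
  by (induction A) (auto simp: ones_def)

lemma ut_analyser_eq: "ut_analyser k n alpha lam y = not_uniform k n alpha lam (count (ones (mset y)))"
proof -
  have "length (filter (\<lambda>m. m = (j, True)) y) = count (ones (mset y)) j" for j
    unfolding count_ones by (induction y) auto
  then show ?thesis by (simp add: ut_analyser_def not_uniform_def Let_def)
qed

lemma not_uniform_cong:
  "(\<And>j. j \<in> {1..k} \<Longrightarrow> c j = c' j) \<Longrightarrow> not_uniform k n alpha lam c = not_uniform k n alpha lam c'"
  by (simp add: not_uniform_def)

text \<open>The decision is constant on all permutations of a multiset, so the shuffling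
  disappears.\<close>

lemma map_ut_analyser_shuffled:
  assumes "lam \<ge> 0"
  shows "map_pmf (ut_analyser k n alpha lam) (ut_shuffled k lam N xs) =
    map_pmf (\<lambda>A. not_uniform k n alpha lam (count (ones A)))
     (return_pmf (\<Sum>x\<leftarrow>xs. base_messages k x) +
      poisson_mset (\<lambda>_. real (length xs) * (lam / (2 * real N))) (messages k))"
proof -
  have "map_pmf (ut_analyser k n alpha lam) (pmf_of_set (permutations_of_multiset A)) =
      return_pmf (not_uniform k n alpha lam (count (ones A)))" for A
  proof -
    have "map_pmf (ut_analyser k n alpha lam) (pmf_of_set (permutations_of_multiset A)) =
        map_pmf (\<lambda>_. not_uniform k n alpha lam (count (ones A))) (pmf_of_set (permutations_of_multiset A))"
      by (intro map_pmf_cong refl) (auto simp: ut_analyser_eq dest: permutations_of_multisetD)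
    then show ?thesis by simp
  qed
  then show ?thesis
    unfolding ut_shuffled_eq[OF assms] map_bind_pmf by (simp add: map_pmf_def)
qed

text \<open>Messages \<open>(j, False)\<close> are mapped to nothing, which leaves one Poisson count
  for each \<open>j\<close>.\<close>

lemma map_ones_poisson_mset:
  "map_pmf ones (poisson_mset (\<lambda>_. c) (messages k)) = poisson_mset (\<lambda>_. c) {1..k}"
proof -
  have "map_pmf ones (poisson_mset (\<lambda>_. c) (messages k)) =
      (\<Sum>z\<in>{1..k} \<times> UNIV. map_pmf (\<lambda>i. ones (replicate_mset i z)) (poi c))"
    unfolding poisson_mset_def messages_def
    by (subst map_pmf_sum) (auto simp: ones_plus map_pmf_comp)
  also have "\<dots> = (\<Sum>j\<in>{1..k}. \<Sum>b\<in>UNIV. map_pmf (\<lambda>i. ones (replicate_mset i (j, b))) (poi c))"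
    by (simp add: sum.cartesian_product case_prod_unfold)
  also have "\<dots> = poisson_mset (\<lambda>_. c) {1..k}"
  proof -
    have "ones (replicate_mset i (j, b)) = (if b then replicate_mset i j else {#})" for i j b
      by (induction i) (auto simp: ones_def)
    then show ?thesis by (simp add: UNIV_bool poisson_mset_def map_pmf_const zero_pmf_def[symmetric])
  qed
  finally show ?thesis .
qed

lemma ones_base_messages: "x \<in> {1..k} \<Longrightarrow> ones (base_messages k x) = {#x#}"
proof -
  assume x: "x \<in> {1..k}"
  have "ones (\<Sum>j\<in>S. {#(j, x = j)#}) = (\<Sum>j\<in>S. if x = j then {#j#} else {#})" if "finite S" for S
    using that by (induction S) (auto simp: ones_plus, auto simp: ones_def)
  with x show ?thesis by (simp add: base_messages_def)
qed

lemma ones_sum_list_base_messages: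
  "set xs \<subseteq> {1..k} \<Longrightarrow> ones (\<Sum>x\<leftarrow>xs. base_messages k x) = mset xs"
  by (induction xs) (auto simp: ones_plus ones_base_messages)

text \<open>Both kernels are run on the same draw from \<open>p\<close>, and they can differ only on
  \<open>Bad\<close>.\<close>

lemma prob_bind_le_of_eq:
  assumes "\<And>x. x \<notin> Bad \<Longrightarrow> x \<in> set_pmf p \<Longrightarrow> f x = g x"
  shows "measure_pmf.prob (bind_pmf p f) S \<le> measure_pmf.prob (bind_pmf p g) S + measure_pmf.prob p Bad"
proof -
  have "emeasure (bind_pmf p f) S \<le> (\<integral>\<^sup>+x. emeasure (g x) S + indicator Bad x \<partial>p)"
    unfolding emeasure_bind_pmf
  proof (intro nn_integral_mono_AE AE_pmfI)
    fix x assume "x \<in> set_pmf p"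
    then show "emeasure (f x) S \<le> emeasure (g x) S + indicator Bad x"
      using assms[of x] measure_pmf.emeasure_le_1[of "f x" S]
      by (cases "x \<in> Bad") (auto intro: add_increasing)
  qed
  also have "\<dots> = emeasure (bind_pmf p g) S + emeasure p Bad"
    by (simp add: nn_integral_add)
  finally show ?thesis
    by (simp add: measure_pmf.emeasure_eq_measure del: emeasure_bind_pmf flip: ennreal_plus)
qed

text \<open>With no users there is no noise at all, so the idealised counts are only correct up to
  the event of probability \<open>exp (- n)\<close> that \<open>N = 0\<close>.\<close>

lemma prob_ut_protocol_ge:
  assumes "lam \<ge> 0" "n \<ge> 0" and p: "set_pmf p \<subseteq> {1..k}"
  shows "measure_pmf.prob (ut_protocol k lam n alpha p) {b} \<ge>
    measure_pmf.prob (Pi_pmf {1..k} 0 (\<lambda>j. poi (n * pmf p j + lam / 2))) {c. not_uniform k n alpha lam c = b}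
    - exp (- n)"
proof -
  let ?test = "\<lambda>A. not_uniform k n alpha lam (count A)"
  define W where "W = poisson_mset (\<lambda>_. lam / 2) {1..k}"
  have "map_pmf (ut_analyser k n alpha lam) (ut_shuffled k lam N xs) = map_pmf ?test (return_pmf (mset xs) + W)"
    if "N > 0" "xs \<in> set_pmf (seq_pmf (replicate N p))" for N xs
  proof -
    have len: "length xs = N" "set xs \<subseteq> {1..k}"
      using set_pmf_seq_pmf[OF that(2)] length_seq_pmf[OF that(2)] p that(1)
      by (simp_all add: set_replicate_conv_if)
    \<comment> \<open>For positive \<open>N\<close> the total noise rate does not depend on
      \<open>N\<close>, so the noise can be separated from the Poissonised sample.\<close>
    have rate: "real (length xs) * (lam / (2 * real N)) = lam / 2"
      using len(1) that(1) by simp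
    have "map_pmf (ut_analyser k n alpha lam) (ut_shuffled k lam N xs) =
        map_pmf ?test (map_pmf ones (return_pmf (\<Sum>x\<leftarrow>xs. base_messages k x) + poisson_mset (\<lambda>_. lam / 2) (messages k)))"
      unfolding map_ut_analyser_shuffled[OF assms(1)] rate map_pmf_comp by (rule refl)
    also have "\<dots> = map_pmf ?test (return_pmf (mset xs) + W)"
      unfolding map_pmf_plus[of ones, OF ones_plus] map_return_pmf ones_sum_list_base_messages[OF len(2)]
        map_ones_poisson_mset W_def by (rule refl)
    finally show ?thesis .
  qed
  then have eq: "bind_pmf (seq_pmf (replicate N p)) (\<lambda>xs. map_pmf ?test (return_pmf (mset xs) + W)) =
      bind_pmf (seq_pmf (replicate N p)) (\<lambda>xs. map_pmf (ut_analyser k n alpha lam) (ut_shuffled k lam N xs))"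
    if "N > 0" for N
    using that by (intro bind_pmf_cong refl) (rule sym)
  \<comment> \<open>With \<open>W\<close> free of \<open>N\<close>, splitting turns the sample into
    independent Poisson counts, and superposition adds the noise rates.\<close>
  have "bind_pmf (poi n) (\<lambda>N. bind_pmf (seq_pmf (replicate N p)) (\<lambda>xs. map_pmf ?test (return_pmf (mset xs) + W))) =
      map_pmf ?test (bind_pmf (poi n) (\<lambda>N. map_pmf mset (seq_pmf (replicate N p))) + W)"
    by (simp add: plus_pmf_def map_pmf_def bind_assoc_pmf bind_return_pmf)
  also have "\<dots> = map_pmf ?test (poisson_mset (\<lambda>j. n * pmf p j + lam / 2) {1..k})"
    using assms by (simp only: bind_poi_iid_mset[OF finite_atLeastAtMost p] W_def) (subst poisson_mset_plus, auto)
  also have "\<dots> = map_pmf (not_uniform k n alpha lam) (Pi_pmf {1..k} 0 (\<lambda>j. poi (n * pmf p j + lam / 2)))"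
    unfolding poisson_mset_Pi_pmf[OF finite_atLeastAtMost] map_pmf_comp
    by (intro map_pmf_cong refl not_uniform_cong) (simp add: count_sum_replicate_mset)
  finally have ideal: "bind_pmf (poi n) (\<lambda>N. bind_pmf (seq_pmf (replicate N p)) (\<lambda>xs. map_pmf ?test (return_pmf (mset xs) + W))) = \<dots>" .
  have "measure_pmf.prob (map_pmf (not_uniform k n alpha lam) (Pi_pmf {1..k} 0 (\<lambda>j. poi (n * pmf p j + lam / 2)))) {b}
      \<le> measure_pmf.prob (ut_protocol k lam n alpha p) {b} + measure_pmf.prob (poi n) {0}"
    unfolding ideal[symmetric] ut_protocol_def
    by (intro prob_bind_le_of_eq eq) auto
  then show ?thesis
    using assms(2) unfolding measure_map_pmf
    by (simp add: measure_pmf_single pmf_poi vimage_def)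
qed

subsection \<open>Sample complexity\<close>

text \<open>The two size conditions control the sampling part and the noise part of
  \<open>sqrt k * mu\<close>, the order of the standard deviation under uniformity, against the
  threshold \<open>tau\<close> for \<open>T\<close>.\<close>

lemma ut_solves_of_bounds:
  fixes lam alpha n :: real and k :: nat
  assumes k: "k \<ge> 2" and lam: "lam \<ge> 0" and alpha: "0 < alpha" "alpha < 1" and n: "n \<ge> 100"
    and sqrt_k: "100 * sqrt (real k) \<le> n * alpha\<^sup>2"
    and noise: "10000 * (real k * sqrt (real k) * lam) \<le> n\<^sup>2 * alpha\<^sup>2"
  shows "ut_solves k lam alpha n"
proof -
  define mu where "mu = n / real k + lam / 2"
  define tau where "tau = 2 * n\<^sup>2 * alpha\<^sup>2 / real k"
  define T where "T c = (\<Sum>j\<in>{1..k}. (real (c j) - mu)\<^sup>2 - real (c j))" for c :: "nat \<Rightarrow> nat"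
  define P where "P p = Pi_pmf {1..k} 0 (\<lambda>j. poi (n * pmf p j + lam / 2))" for p
  have k0: "real k > 0" and n0: "n > 0" using k n by auto
  have mu0: "mu > 0" using k0 n0 lam by (simp add: mu_def add_pos_nonneg)
  have tau0: "tau > 0" using k0 n0 alpha by (simp add: tau_def)
  have dec: "not_uniform k n alpha lam c \<longleftrightarrow> T c > tau" for c
    using k0 n0 unfolding not_uniform_def T_def[symmetric] mu_def[symmetric] tau_def
    by (simp add: field_simps power2_eq_square)
  have tail: "measure_pmf.prob (P p) {c. \<bar>T c - (\<Sum>j\<in>{1..k}. (n * pmf p j + lam / 2 - mu)\<^sup>2)\<bar> \<ge> a}
      \<le> (\<Sum>j\<in>{1..k}. 2 * (n * pmf p j + lam / 2)\<^sup>2 + 4 * (n * pmf p j + lam / 2 - mu)\<^sup>2 * (n * pmf p j + lam / 2)) / a\<^sup>2"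
    if "a > 0" for a p
    unfolding P_def T_def using that lam n0 by (intro poi_stat_concentration) auto
  have exp_n: "exp (- n) \<le> 1 / 100"
  proof -
    have "100 \<le> exp n" using n exp_ge_add_one_self[of n] by linarith
    then show ?thesis by (simp add: exp_minus field_simps)
  qed
  have sk: "sqrt (real k) * sqrt (real k) = real k" "sqrt (real k) \<ge> 1" using k by auto
  \<comment> \<open>In units of \<open>n^2 * alpha^2 / k\<close>, sampling contributes at most 2 and
    noise at most 1/100, while \<open>tau\<close> equals 2.\<close>
  have mu_tau: "200 * (sqrt (real k) * mu) \<le> 201 / 200 * tau"
  proof -
    have "100 * (sqrt (real k) * n) \<le> n\<^sup>2 * alpha\<^sup>2"
      using mult_left_mono[OF sqrt_k, of n] n0 by (simp add: power2_eq_square mult_ac)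
    then have "200 * (sqrt (real k) * mu) * real k \<le> 201 / 100 * (n\<^sup>2 * alpha\<^sup>2)"
      using noise k0 by (simp add: mu_def algebra_simps)
    then show ?thesis using k0 by (simp add: tau_def field_simps)
  qed
  have "measure_pmf.prob (P (unif k)) {c. \<bar>T c\<bar> \<ge> tau} \<le> 1 / 100"
  proof -
    have u: "n * pmf (unif k) j + lam / 2 = mu" if "j \<in> {1..k}" for j
      using that k by (simp add: unif_def mu_def)
    have "measure_pmf.prob (P (unif k)) {c. \<bar>T c\<bar> \<ge> tau} \<le> real k * (2 * mu\<^sup>2) / tau\<^sup>2"
      using tail[OF tau0, of "unif k"] u by simp
    also have "\<dots> = 2 * (sqrt (real k) * mu / tau)\<^sup>2"
      using k0 by (simp add: power_divide power_mult_distrib)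
    also have "\<dots> \<le> 2 * (1 / 100)\<^sup>2"
      using mu_tau tau0 mu0 by (intro mult_left_mono power_mono) (auto simp: field_simps)
    finally show ?thesis by (simp add: power2_eq_square)
  qed
  moreover have "1 - measure_pmf.prob (P (unif k)) {c. \<bar>T c\<bar> \<ge> tau} \<le> measure_pmf.prob (P (unif k)) {c. not_uniform k n alpha lam c = False}"
  proof -
    have "1 - measure_pmf.prob (P (unif k)) {c. \<bar>T c\<bar> \<ge> tau} = measure_pmf.prob (P (unif k)) (- {c. \<bar>T c\<bar> \<ge> tau})"
      by (simp add: measure_pmf.prob_compl[symmetric] Compl_eq_Diff_UNIV)
    also have "\<dots> \<le> measure_pmf.prob (P (unif k)) {c. not_uniform k n alpha lam c = False}"
      by (intro measure_pmf.finite_measure_mono) (auto simp: dec)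
    finally show ?thesis .
  qed
  moreover have "set_pmf (unif k) \<subseteq> {1..k}" using k by (simp add: unif_def)
  ultimately have uniform: "measure_pmf.prob (ut_protocol k lam n alpha (unif k)) {False} \<ge> 2 / 3"
    using prob_ut_protocol_ge[of lam n "unif k" k alpha False] lam n0 exp_n unfolding P_def by auto
  have far: "measure_pmf.prob (ut_protocol k lam n alpha p) {True} \<ge> 2 / 3"
    if p: "set_pmf p \<subseteq> {1..k}" and tv: "tv_dist_k k p (unif k) > alpha" for p
  proof -
    define D where "D = (\<Sum>j\<in>{1..k}. (n * pmf p j + lam / 2 - mu)\<^sup>2)"
    define \<Delta> where "\<Delta> j = n * pmf p j + lam / 2 - mu" for j
    have D: "D = (\<Sum>j\<in>{1..k}. (\<Delta> j)\<^sup>2)" by (simp add: D_def \<Delta>_def)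
    have \<Delta>: "\<Delta> j = n * (pmf p j - pmf (unif k) j)" if "j \<in> {1..k}" for j
      using that k by (simp add: unif_def mu_def \<Delta>_def field_simps)
    \<comment> \<open>A distance above \<open>alpha\<close> is an l1 distance above
      \<open>2 * alpha\<close>; Cauchy-Schwarz then makes the mean \<open>D\<close> of
      \<open>T\<close> at least twice the threshold.\<close>
    have "2 * n * alpha < n * (\<Sum>j\<in>{1..k}. \<bar>pmf p j - pmf (unif k) j\<bar>)"
      using tv n0 by (simp add: tv_dist_k_def)
    also have "\<dots> = (\<Sum>j\<in>{1..k}. \<bar>\<Delta> j\<bar>)"
      using n0 \<Delta> by (simp add: sum_distrib_left abs_mult)
    finally have "(2 * n * alpha)\<^sup>2 \<le> (\<Sum>j\<in>{1..k}. \<bar>\<Delta> j\<bar>)\<^sup>2"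
      using n0 alpha by (intro power_mono) auto
    also have "\<dots> \<le> D * real k"
      using sum_squared_le_sum_of_squares[of "\<lambda>j. \<bar>\<Delta> j\<bar>" "{1..k}"] by (simp add: D)
    finally have D_tau: "D \<ge> 2 * tau"
      using k0 by (simp add: tau_def field_simps power2_eq_square)
    have D0: "D > 0" using D_tau tau0 by linarith
    \<comment> \<open>Large \<open>D\<close> makes \<open>sqrt D\<close> and additive constants
      small multiples of \<open>D\<close> in the variance bound.\<close>
    have D_big: "D \<ge> 40000"
    proof -
      have "(100 * sqrt (real k))\<^sup>2 \<le> (n * alpha\<^sup>2)\<^sup>2"
        using sqrt_k by (intro power_mono) auto
      also have "\<dots> = n\<^sup>2 * alpha\<^sup>2 * alpha\<^sup>2" by (simp add: power2_eq_square)
      also have "\<dots> \<le> n\<^sup>2 * alpha\<^sup>2 * 1"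
        using alpha by (intro mult_left_mono) (auto simp: power_le_one)
      finally have "10000 * real k \<le> n\<^sup>2 * alpha\<^sup>2" by (simp add: power_mult_distrib)
      then have "tau \<ge> 20000" using k0 by (simp add: tau_def field_simps)
      then show ?thesis using D_tau by linarith
    qed
    define s where "s = sqrt D"
    have s: "s\<^sup>2 = D" "s \<ge> 200" "s > 0"
      using D_big real_le_rsqrt[of 200 D] D0 by (auto simp: s_def)
    have abs_s: "\<bar>\<Delta> j\<bar> \<le> s" if "j \<in> {1..k}" for j
    proof -
      have "(\<Delta> j)\<^sup>2 \<le> D" unfolding D using that by (intro member_le_sum) auto
      then show ?thesis by (simp add: s_def real_le_rsqrt real_le_lsqrt real_sqrt_abs[symmetric] del: real_sqrt_abs)
    qed
    \<comment> \<open>Each rate is \<open>mu + \<Delta> j\<close>, and a single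
      \<open>\<bar>\<Delta> j\<bar>\<close> is at most \<open>s = sqrt D\<close>; this bounds the
      cubic terms by multiples of the squares that add up to \<open>D\<close>.\<close>
    have "(\<Sum>j\<in>{1..k}. 2 * (n * pmf p j + lam / 2)\<^sup>2 + 4 * (n * pmf p j + lam / 2 - mu)\<^sup>2 * (n * pmf p j + lam / 2))
        \<le> (\<Sum>j\<in>{1..k}. 4 * mu\<^sup>2 + (4 + 4 * mu + 4 * s) * (\<Delta> j)\<^sup>2)"
    proof (rule sum_mono)
      fix j assume j: "j \<in> {1..k}"
      have nu: "n * pmf p j + lam / 2 = mu + \<Delta> j" by (simp add: \<Delta>_def)
      have "2 * (mu + \<Delta> j)\<^sup>2 \<le> 4 * mu\<^sup>2 + 4 * (\<Delta> j)\<^sup>2"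
        using zero_le_power2[of "mu - \<Delta> j"] by (simp add: power2_eq_square algebra_simps)
      moreover have "4 * (\<Delta> j)\<^sup>2 * (mu + \<Delta> j) \<le> 4 * (\<Delta> j)\<^sup>2 * (mu + s)"
        using abs_s[OF j] by (intro mult_left_mono) auto
      ultimately show "2 * (n * pmf p j + lam / 2)\<^sup>2 + 4 * (n * pmf p j + lam / 2 - mu)\<^sup>2 * (n * pmf p j + lam / 2)
          \<le> 4 * mu\<^sup>2 + (4 + 4 * mu + 4 * s) * (\<Delta> j)\<^sup>2"
        unfolding nu by (simp add: algebra_simps)
    qed
    also have "\<dots> = 4 * (sqrt (real k) * mu)\<^sup>2 + (4 + 4 * mu + 4 * s) * D"
      using k0 by (simp add: sum.distrib D sum_distrib_left power_mult_distrib)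
    also have "\<dots> \<le> D\<^sup>2 / 20"
    proof -
      have A: "sqrt (real k) * mu \<le> D / 300" using mu_tau D_tau D0 by linarith
      have "1 * mu \<le> sqrt (real k) * mu" using sk mu0 by (intro mult_right_mono) auto
      then have B: "mu \<le> D / 300" using A by linarith
      have "200 * s \<le> s * s" using s by (intro mult_right_mono) auto
      then have "s \<le> D / 200" using s(1) by (simp add: power2_eq_square)
      then have "4 + 4 * mu + 4 * s \<le> D / 25" using B D_big by linarith
      then have "(4 + 4 * mu + 4 * s) * D \<le> D / 25 * D" using D0 by (intro mult_right_mono) auto
      moreover have "(sqrt (real k) * mu)\<^sup>2 \<le> (D / 300)\<^sup>2" using A mu0 by (intro power_mono) auto
      moreover have "(D / 300)\<^sup>2 = D\<^sup>2 / 90000" "D / 25 * D = D\<^sup>2 / 25"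
        by (simp_all add: power2_eq_square)
      ultimately show ?thesis using zero_le_power2[of D] by linarith
    qed
    finally have var: "(\<Sum>j\<in>{1..k}. 2 * (n * pmf p j + lam / 2)\<^sup>2
        + 4 * (n * pmf p j + lam / 2 - mu)\<^sup>2 * (n * pmf p j + lam / 2)) \<le> D\<^sup>2 / 20" .
    \<comment> \<open>A deviation below \<open>D / 2\<close> keeps \<open>T\<close> above
      \<open>D / 2\<close>, hence above \<open>tau\<close>. Chebyshev leaves an error of 1/5, plus
      at most 1/100 for \<open>N = 0\<close>.\<close>
    have "measure_pmf.prob (P p) {c. \<bar>T c - D\<bar> \<ge> D / 2} \<le> D\<^sup>2 / 20 / (D / 2)\<^sup>2"
      using D0 by (intro order_trans[OF tail[of "D / 2" p, folded D_def] divide_right_mono[OF var]]) auto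
    also have "\<dots> = 1 / 5" using D0 by (simp add: power2_eq_square)
    finally have "measure_pmf.prob (P p) {c. \<bar>T c - D\<bar> \<ge> D / 2} \<le> 1 / 5" .
    moreover have "1 - measure_pmf.prob (P p) {c. \<bar>T c - D\<bar> \<ge> D / 2} \<le> measure_pmf.prob (P p) {c. not_uniform k n alpha lam c = True}"
    proof -
      have "1 - measure_pmf.prob (P p) {c. \<bar>T c - D\<bar> \<ge> D / 2} = measure_pmf.prob (P p) (- {c. \<bar>T c - D\<bar> \<ge> D / 2})"
        by (simp add: measure_pmf.prob_compl[symmetric] Compl_eq_Diff_UNIV)
      also have "\<dots> \<le> measure_pmf.prob (P p) {c. not_uniform k n alpha lam c = True}"
        using D_tau by (intro measure_pmf.finite_measure_mono) (auto simp: dec abs_if split: if_splits)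
      finally show ?thesis .
    qed
    ultimately show ?thesis
      using prob_ut_protocol_ge[OF lam _ p, of n alpha True] n0 exp_n unfolding P_def by auto
  qed
  show ?thesis unfolding ut_solves_def using uniform far by auto
qed

section \<open>Sample size for the chosen noise rate\<close>

text \<open>Replacing \<open>min 1 eps\<close> by \<open>eps\<close> costs a constant factor as long
  as \<open>eps\<close> stays below a fixed \<open>eps0\<close>.\<close>

lemma noise_rate_le:
  assumes "0 < eps" "eps \<le> eps0" "0 < del" "del < 1"
  shows "noise_rate eps del \<le> 44 * (1 + eps0\<^sup>2) * ln (1 / del) / eps\<^sup>2"
proof -
  have "eps\<^sup>2 \<le> (1 + eps0\<^sup>2) * (min 1 eps)\<^sup>2"
    using power_mono[OF assms(2), of 2] assms(1) by (auto simp: min_def algebra_simps)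
  then have "1 / (min 1 eps)\<^sup>2 \<le> (1 + eps0\<^sup>2) / eps\<^sup>2"
    using assms(1) by (simp add: field_simps)
  then have "44 * ln (1 / del) * (1 / (min 1 eps)\<^sup>2) \<le> 44 * ln (1 / del) * ((1 + eps0\<^sup>2) / eps\<^sup>2)"
    using assms by (intro mult_left_mono) auto
  then show ?thesis by (simp add: noise_rate_def mult_ac)
qed

text \<open>The summand \<open>u\<close> of the sample size pays for the noise, the summand
  \<open>v\<close> for sampling; since \<open>v\<close> is at least 1, it also makes
  \<open>n\<close> large enough to neglect \<open>N = 0\<close>.\<close>

lemma ut_solves_noise_rate:
  fixes k :: nat and eps del alpha n eps0 :: real
  assumes k: "k \<ge> 2" and eps: "0 < eps" "eps \<le> eps0" and del: "0 < del" "del < 1"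
    and alpha: "0 < alpha" "alpha < 1"
    and n: "n \<ge> 700 * (1 + eps0) * (real k powr (3/4) / (alpha * eps) * sqrt (ln (1 / del)) + sqrt (real k) / alpha\<^sup>2)"
  shows "ut_solves k (noise_rate eps del) alpha n"
proof -
  define u where "u = real k powr (3/4) / (alpha * eps) * sqrt (ln (1 / del))"
  define v where "v = sqrt (real k) / alpha\<^sup>2"
  have u: "u \<ge> 0" using alpha eps del by (simp add: u_def)
  have v: "v \<ge> 1"
  proof -
    have "alpha\<^sup>2 \<le> 1" using alpha by (simp add: power_le_one)
    also have "1 \<le> sqrt (real k)" using k by simp
    finally show ?thesis using alpha by (simp add: v_def)
  qed
  have n_le: "700 * (1 + eps0) * (u + v) \<le> n" using n by (simp add: u_def v_def)
  have "700 * v \<le> 700 * (1 + eps0) * (u + v)"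
    using u v eps by (intro mult_mono) auto
  then have nv: "n \<ge> 700 * v" using n_le by linarith
  have "700 * (1 + eps0) * u \<le> 700 * (1 + eps0) * (u + v)"
    using u v eps by (intro mult_left_mono) auto
  then have nu: "700 * (1 + eps0) * u \<le> n" using n_le by linarith
  show ?thesis
  proof (rule ut_solves_of_bounds)
    show "n \<ge> 100" using nv v by linarith
    have "100 * v \<le> n" using nv v by linarith
    then show "100 * sqrt (real k) \<le> n * alpha\<^sup>2" using alpha by (simp add: v_def field_simps)
    have kk: "(real k powr (3/4))\<^sup>2 = real k * sqrt (real k)"
    proof -
      have "(real k powr (3/4))\<^sup>2 = real k powr (1 + 1/2)"
        by (simp add: power2_eq_square flip: powr_add)
      also have "\<dots> = real k * sqrt (real k)"
        using k by (subst powr_add) (simp add: powr_half_sqrt)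
      finally show ?thesis .
    qed
    have ln0: "ln (1 / del) \<ge> 0" using del by simp
    have u2: "u\<^sup>2 = real k * sqrt (real k) * ln (1 / del) / (alpha\<^sup>2 * eps\<^sup>2)"
      using ln0 by (simp add: u_def power_mult_distrib power_divide kk)
    have "10000 * (real k * sqrt (real k) * noise_rate eps del)
        \<le> 10000 * (real k * sqrt (real k) * (44 * (1 + eps0\<^sup>2) * ln (1 / del) / eps\<^sup>2))"
      using noise_rate_le[OF eps del] by (intro mult_left_mono) auto
    also have "\<dots> = 440000 * (1 + eps0\<^sup>2) * (u\<^sup>2 * alpha\<^sup>2)"
      using alpha by (simp add: u2)
    \<comment> \<open>This fixes the constant 700: its square 490000 exceeds 440000, and
      \<open>1 + eps0^2\<close> is at most \<open>(1 + eps0)^2\<close>.\<close>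
    also have "\<dots> \<le> (700 * (1 + eps0))\<^sup>2 * (u\<^sup>2 * alpha\<^sup>2)"
      using eps by (intro mult_right_mono) (simp add: power2_eq_square algebra_simps, simp)
    also have "\<dots> = (700 * (1 + eps0) * u)\<^sup>2 * alpha\<^sup>2" by (simp add: power_mult_distrib)
    also have "\<dots> \<le> n\<^sup>2 * alpha\<^sup>2"
      using nu u eps by (intro mult_right_mono power_mono) auto
    finally show "10000 * (real k * sqrt (real k) * noise_rate eps del) \<le> n\<^sup>2 * alpha\<^sup>2" .
  qed (use k alpha eps del noise_rate_pos[of eps del] in auto)
qed

text \<open>The noise rate is chosen from \<open>eps\<close> and \<open>del\<close> alone, before
  \<open>k\<close>, \<open>gamma\<close> and \<open>alpha\<close>. The bound \<open>eps0\<close>, on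
  which \<open>C\<close> may depend, expresses \<open>eps = O(1)\<close>, and \<open>del0\<close>
  expresses \<open>del = o(1)\<close>.\<close>

theorem theorem3p2:
  "\<exists>lam :: real \<Rightarrow> real \<Rightarrow> real.
     (\<forall>eps del. eps > 0 \<longrightarrow> 0 < del \<longrightarrow> del < 1 \<longrightarrow>
        lam eps del > 0 \<and>
        (\<forall>(k::nat) (gamma::real). k \<ge> 2 \<longrightarrow> 0 < gamma \<longrightarrow> gamma \<le> 1 \<longrightarrow>
           ut_robust_private k (lam eps del) (2 * eps) (4 * del powr gamma) gamma))
   \<and> (\<forall>eps0 > 0. \<exists>C > 0. \<exists>del0. 0 < del0 \<and> del0 < 1 \<and>
        (\<forall>(k::nat) eps del alpha (n::real).
           k \<ge> 2 \<longrightarrow> 0 < eps \<longrightarrow> eps \<le> eps0 \<longrightarrow> 0 < del \<longrightarrow> del < del0 \<longrightarrow>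
           0 < alpha \<longrightarrow> alpha < 1 \<longrightarrow>
           n \<ge> C * (real k powr (3/4) / (alpha * eps) * sqrt (ln (1 / del))
                    + sqrt (real k) / alpha^2) \<longrightarrow>
           ut_solves k (lam eps del) alpha n))"
proof (rule exI[of _ noise_rate], intro conjI allI impI)
  fix eps0 :: real assume eps0: "eps0 > 0"
  show "\<exists>C > 0. \<exists>del0. 0 < del0 \<and> del0 < 1 \<and>
        (\<forall>(k::nat) eps del alpha (n::real).
           k \<ge> 2 \<longrightarrow> 0 < eps \<longrightarrow> eps \<le> eps0 \<longrightarrow> 0 < del \<longrightarrow> del < del0 \<longrightarrow>
           0 < alpha \<longrightarrow> alpha < 1 \<longrightarrow>
           n \<ge> C * (real k powr (3/4) / (alpha * eps) * sqrt (ln (1 / del))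
                    + sqrt (real k) / alpha^2) \<longrightarrow>
           ut_solves k (noise_rate eps del) alpha n)"
    using eps0 ut_solves_noise_rate[of _ _ eps0]
    by (rule_tac exI[of _ "700 * (1 + eps0)"], simp, rule_tac exI[of _ "1 / 2"], simp)
next
  fix eps del :: real
  assume "eps > 0" "0 < del" "del < 1"
  then show "noise_rate eps del > 0" by (rule noise_rate_pos)
next
  fix eps del gamma :: real and k :: nat
  assume "eps > 0" "0 < del" "del < 1" "0 < gamma"
  then show "ut_robust_private k (noise_rate eps del) (2 * eps) (4 * del powr gamma) gamma"
    by (rule ut_robust_private_noise_rate)
qed

end
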